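(* Let $\mathcal{M}$ be a finite dimensional von Neumann algebra, and let $\mathcal{A}\subseteq\mathcal{M}$ be a unital subalgebra that is logmodular in $\mathcal{M}$. Then $\mathcal{A}$ is a nest subalgebra of $\mathcal{M}$, and $\mathcal{A}$ is $\mathcal{M}$-reflexive.
   Context: Subalgebras are not assumed self-adjoint; they contain the identity $1$ of $\mathcal{M}$. Projections are orthogonal projections. $\mathcal{A}^{-1}=\{a\in\mathcal{A}: a \text{ is invertible and } a^{-1}\in\mathcal{A}\}$, and $\mathcal{M}_+^{-1}$ is the set of positive invertible elements of $\mathcal{M}$. $\mathcal{A}$ is logmodular in $\mathcal{M}$ if $\{a^*a: a\in\mathcal{A}^{-1}\}$ is norm dense in $\mathcal{M}_+^{-1}$. $\mathrm{Lat}_{\mathcal{M}}\mathcal{A}=\{p\in\mathcal{M}: p=p^2=p^*,\ ap=pap\ \forall a\in\mathcal{A}\}$. For a collection $\mathcal{E}$ of projections in $\mathcal{M}$, $\mathrm{Alg}_{\mathcal{M}}\mathcal{E}=\{x\in\mathcal{M}: xp=pxp\ \forall p\in\mathcal{E}\}$. $\mathcal{A}$ is $\mathcal{M}$-reflexive if $\mathcal{A}=\mathrm{Alg}_{\mathcal{M}}\mathrm{Lat}_{\mathcal{M}}\mathcal{A}$. A nest in $\mathcal{M}$ is a lattice of projections in $\mathcal{M}$ totally ordered by the operator order; $\mathcal{A}$ is a nest subalgebra of $\mathcal{M}$ if $\mathcal{A}=\mathrm{Alg}_{\mathcal{M}}\mathcal{E}$ for some nest $\mathcal{E}$ in $\mathcal{M}$.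 *)

theory Defs
  imports "HOL-Analysis.Analysis"
begin

section \<open>Complex Hilbert spaces\<close>

text \<open>The inner product is linear in its \<^emph>\<open>first\<close> argument. Completeness comes from the superclass
  \<^class>\<open>banach\<close>; neither finite dimension, separability nor nontriviality is assumed.\<close>

class complex_hilbert_space = banach +
  fixes scaleC :: "complex \<Rightarrow> 'a \<Rightarrow> 'a" (infixr "*\<^sub>C" 75)
    and cinner :: "'a \<Rightarrow> 'a \<Rightarrow> complex"
  assumes scaleC_add_right: "a *\<^sub>C (x + y) = a *\<^sub>C x + a *\<^sub>C y"
    and scaleC_add_left: "(a + b) *\<^sub>C x = a *\<^sub>C x + b *\<^sub>C x"
    and scaleC_scaleC: "a *\<^sub>C (b *\<^sub>C x) = (a * b) *\<^sub>C x"
    and scaleR_scaleC: "r *\<^sub>R x = complex_of_real r *\<^sub>C x"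
    and cinner_commute: "cinner x y = cnj (cinner y x)"
    and cinner_add_left: "cinner (x + y) z = cinner x z + cinner y z"
    and cinner_scaleC_left: "cinner (a *\<^sub>C x) y = a * cinner x y"
    and cinner_ge_zero: "0 \<le> Re (cinner x x)"
    and norm_eq_sqrt_cinner: "norm x = sqrt (Re (cinner x x))"

lemma scaleC_one: "1 *\<^sub>C x = x"
  using scaleR_scaleC[of 1 x] by simp

lemma cinner_add_right: "cinner x (y + z) = cinner x y + cinner x z"
  by (metis cinner_commute cinner_add_left complex_cnj_add)

lemma cinner_scaleC_right: "cinner x (a *\<^sub>C y) = cnj a * cinner x y"
  by (metis cinner_commute cinner_scaleC_left complex_cnj_mult)

lemma cinner_scaleR_left: "cinner (r *\<^sub>R x) y = r * cinner x y"
  by (simp add: scaleR_scaleC cinner_scaleC_left)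

lemma cinner_scaleR_right: "cinner x (r *\<^sub>R y) = r * cinner x y"
  by (simp add: scaleR_scaleC cinner_scaleC_right)

lemma cinner_minus_left: "cinner (- x) y = - cinner x y"
  using cinner_scaleR_left[of "-1" x y] by simp

lemma cinner_minus_right: "cinner x (- y) = - cinner x y"
  using cinner_scaleR_right[of x "-1" y] by simp

lemma cinner_diff_left: "cinner (x - y) z = cinner x z - cinner y z"
  using cinner_add_left[of x "-y" z] by (simp add: cinner_minus_left)

lemma cinner_diff_right: "cinner x (y - z) = cinner x y - cinner x z"
  using cinner_add_right[of x y "-z"] by (simp add: cinner_minus_right)

lemma Re_cinner_commute: "Re (cinner x y) = Re (cinner y x)"
  by (subst cinner_commute) simp

lemma Im_cinner_self: "Im (cinner x x) = 0"
proof -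
  have "Im (cinner x x) = - Im (cinner x x)"
    by (subst cinner_commute) simp
  then show ?thesis by simp
qed

lemma power2_norm_eq_cinner: "(norm x)\<^sup>2 = Re (cinner x x)"
  by (simp add: norm_eq_sqrt_cinner cinner_ge_zero)

lemma norm_scaleC: "norm (a *\<^sub>C x) = cmod a * norm x"
proof -
  have "cinner (a *\<^sub>C x) (a *\<^sub>C x) = of_real ((cmod a)\<^sup>2) * cinner x x"
    by (simp only: cinner_scaleC_left cinner_scaleC_right complex_norm_square mult_ac)
  then have "(norm (a *\<^sub>C x))\<^sup>2 = (cmod a * norm x)\<^sup>2"
    by (simp add: power2_norm_eq_cinner power_mult_distrib)
  then show ?thesis
    by (simp add: power2_eq_iff_nonneg)
qed

lemma norm_add_square: "(norm (x + y))\<^sup>2 = (norm x)\<^sup>2 + 2 * Re (cinner x y) + (norm y)\<^sup>2"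
  by (simp add: power2_norm_eq_cinner cinner_add_left cinner_add_right Re_cinner_commute[of y x])

lemma norm_diff_square: "(norm (x - y))\<^sup>2 = (norm x)\<^sup>2 - 2 * Re (cinner x y) + (norm y)\<^sup>2"
  by (simp add: power2_norm_eq_cinner cinner_diff_left cinner_diff_right Re_cinner_commute[of y x])

lemma cinner_eqI:
  assumes "\<And>u. cinner u x = cinner u y"
  shows "x = y"
proof -
  have "(norm (x - y))\<^sup>2 = 0"
    unfolding power2_norm_eq_cinner using assms[of "x - y"] by (simp add: cinner_diff_right)
  then show ?thesis by simp
qed

lemma Re_cinner_le: "Re (cinner x y) \<le> norm x * norm y"
proof (cases "norm x = 0 \<or> norm y = 0")
  case True
  have "cinner 0 y = 0" "cinner x 0 = 0"
    using cinner_minus_left[of 0 y] cinner_minus_right[of x 0] by auto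
  with True show ?thesis by auto
next
  case False
  have "(norm (norm y *\<^sub>R x - norm x *\<^sub>R y))\<^sup>2
      = 2 * (norm x * norm y) * (norm x * norm y - Re (cinner x y))"
    unfolding norm_diff_square cinner_scaleR_left cinner_scaleR_right
    by (simp add: power2_eq_square algebra_simps)
  then have "0 \<le> 2 * (norm x * norm y) * (norm x * norm y - Re (cinner x y))"
    by (metis zero_le_power2)
  moreover have "0 < 2 * (norm x * norm y)"
    using False by simp
  ultimately show ?thesis
    by (simp add: zero_le_mult_iff)
qed

section \<open>Bounded operators\<close>

text \<open>The type \<open>'h \<Rightarrow>\<^sub>L 'h\<close> consists of the bounded \<^emph>\<open>real\<close>-linear operators; its complex-linear
  elements are the algebra $B(H)$ of the Hilbert space. Its norm is the operator norm.\<close>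

definition bounded_operators :: "('h::complex_hilbert_space \<Rightarrow>\<^sub>L 'h) set"
  where "bounded_operators = {x. \<forall>c v. blinfun_apply x (c *\<^sub>C v) = c *\<^sub>C blinfun_apply x v}"

lift_definition scalar_op :: "complex \<Rightarrow> 'h::complex_hilbert_space \<Rightarrow>\<^sub>L 'h"
  is "\<lambda>c v. c *\<^sub>C v"
proof
  fix c r and x y :: 'h
  show "c *\<^sub>C (x + y) = c *\<^sub>C x + c *\<^sub>C y"
    by (rule scaleC_add_right)
  show "c *\<^sub>C (r *\<^sub>R x) = r *\<^sub>R (c *\<^sub>C x)"
    by (simp add: scaleR_scaleC scaleC_scaleC mult.commute)
  show "\<exists>K. \<forall>x::'h. norm (c *\<^sub>C x) \<le> norm x * K"
    by (intro exI[of _ "cmod c"]) (simp add: norm_scaleC)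
qed

definition scale_op :: "complex \<Rightarrow> ('h::complex_hilbert_space \<Rightarrow>\<^sub>L 'h) \<Rightarrow> 'h \<Rightarrow>\<^sub>L 'h"
  where "scale_op c x = scalar_op c o\<^sub>L x"

lemma scale_op_apply: "blinfun_apply (scale_op c x) v = c *\<^sub>C blinfun_apply x v"
  by (simp add: scale_op_def scalar_op.rep_eq)

global_interpretation cop: vector_space "scale_op :: complex \<Rightarrow> ('h::complex_hilbert_space \<Rightarrow>\<^sub>L 'h) \<Rightarrow> _"
  by unfold_locales
    (auto intro!: blinfun_eqI simp: scale_op_apply plus_blinfun.rep_eq scaleC_add_right
      scaleC_add_left scaleC_scaleC scaleC_one)

definition adj :: "('h::complex_hilbert_space \<Rightarrow>\<^sub>L 'h) \<Rightarrow> 'h \<Rightarrow>\<^sub>L 'h"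
  where "adj x = (THE y. \<forall>u v. cinner (blinfun_apply x u) v = cinner u (blinfun_apply y v))"

text \<open>The following lemmas (via the Riesz representation theorem) show that the description in
  \<^const>\<open>adj\<close> is proper on $B(H)$.\<close>

lemma adj_eqI:
  assumes "\<And>u v. cinner (blinfun_apply x u) v = cinner u (blinfun_apply y v)"
  shows "adj x = y"
  unfolding adj_def
proof (rule the_equality)
  show "\<forall>u v. cinner (blinfun_apply x u) v = cinner u (blinfun_apply y v)"
    using assms by blast
  fix z assume "\<forall>u v. cinner (blinfun_apply x u) v = cinner u (blinfun_apply z v)"
  then show "z = y"
    using assms by (intro blinfun_eqI cinner_eqI) metis
qed

lemma real_riesz:
  fixes g :: "'h::complex_hilbert_space \<Rightarrow> real"
  assumes g: "bounded_linear g"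
  shows "\<exists>w. \<forall>u. Re (cinner u w) = g u"
proof -
  interpret g: bounded_linear g by (rule g)
  obtain C where C: "\<And>u. norm (g u) \<le> norm u * C"
    using g.bounded by blast
  define J where "J w = (norm w)\<^sup>2 - 2 * g w" for w
  have J_ge: "- C\<^sup>2 \<le> J w" for w
  proof -
    have "g w \<le> norm w * C"
      using C[of w] by simp
    moreover have "0 \<le> (norm w - C)\<^sup>2"
      by simp
    ultimately show ?thesis
      unfolding J_def by (simp add: power2_eq_square algebra_simps)
  qed
  define m where "m = Inf (range J)"
  have bdd: "bdd_below (range J)"
    using J_ge by (auto intro!: bdd_belowI[of _ "- C\<^sup>2"])
  have m_le: "m \<le> J w" for w
    unfolding m_def using bdd by (simp add: cInf_lower)
  have "\<exists>w. J w < m + 1 / real (Suc n)" for n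
  proof -
    have "Inf (range J) < m + 1 / real (Suc n)"
      unfolding m_def by simp
    then show ?thesis
      using cInf_lessD[of "range J"] by blast
  qed
  then obtain W where W: "\<And>n. J (W n) < m + 1 / real (Suc n)"
    by metis
  have par: "(norm (a - b))\<^sup>2 \<le> 2 * (J a - m) + 2 * (J b - m)" for a b
  proof -
    have "4 * J ((1/2) *\<^sub>R (a + b)) = (norm (a + b))\<^sup>2 - 4 * (g a + g b)"
      unfolding J_def g.scaleR g.add norm_scaleR power_mult_distrib by (simp add: power2_eq_square add_divide_distrib)
    then show ?thesis
      using m_le[of "(1/2) *\<^sub>R (a + b)"] unfolding J_def norm_diff_square norm_add_square by simp
  qed
  have "Cauchy W"
  proof (rule metric_CauchyI)
    fix e :: real assume "0 < e"
    then obtain N where N: "4 / e\<^sup>2 < real N"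
      using reals_Archimedean2 by blast
    have small: "2 * (J (W n) - m) < e\<^sup>2 / 2" if "N \<le> n" for n
    proof -
      have "4 / e\<^sup>2 < real (Suc n)"
        using N that by linarith
      then have "2 / real (Suc n) < e\<^sup>2 / 2"
        using \<open>0 < e\<close> by (simp add: field_simps)
      then show ?thesis
        using W[of n] by simp
    qed
    have "dist (W a) (W b) < e" if "N \<le> a" "N \<le> b" for a b
    proof -
      have "(norm (W a - W b))\<^sup>2 < e\<^sup>2"
        using par[of "W a" "W b"] small[OF that(1)] small[OF that(2)] by simp
      then show ?thesis
        using \<open>0 < e\<close> by (simp add: dist_norm power2_less_imp_less)
    qed
    then show "\<exists>N. \<forall>a\<ge>N. \<forall>b\<ge>N. dist (W a) (W b) < e"
      by blast
  qed
  then obtain w where w: "W \<longlonglongrightarrow> w"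
    using Cauchy_convergent convergent_def by blast
  have "(\<lambda>n. J (W n)) \<longlonglongrightarrow> J w"
    unfolding J_def by (intro tendsto_intros g.tendsto w)
  moreover have "(\<lambda>n. m + 1 / real (Suc n)) \<longlonglongrightarrow> m + 0"
    by (intro tendsto_intros LIMSEQ_Suc lim_1_over_n)
  ultimately have "J w \<le> m + 0"
    using W by (intro LIMSEQ_le[of "\<lambda>n. J (W n)" _ "\<lambda>n. m + 1 / real (Suc n)"])
      (auto intro: less_imp_le)
  then have min: "J w \<le> J v" for v
    using m_le[of v] by simp
  have "Re (cinner u w) = g u" for u
  proof -
    define d where "d = Re (cinner w u) - g u"
    define q where "q = (norm u)\<^sup>2"
    have ineq: "0 \<le> 2 * t * d + t\<^sup>2 * q" for t :: real
      using min[of "w + t *\<^sub>R u"]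
      unfolding J_def norm_add_square cinner_scaleR_right d_def q_def
      by (simp add: g.add g.scaleR power_mult_distrib algebra_simps)
    have "0 \<le> q" unfolding q_def by simp
    have "2 * (- d / (1 + q)) * d + (- d / (1 + q))\<^sup>2 * q = - (d\<^sup>2 * (2 + q) / (1 + q)\<^sup>2)"
      using \<open>0 \<le> q\<close> by (simp add: divide_simps power2_eq_square) (simp add: algebra_simps)
    then have "d\<^sup>2 * (2 + q) / (1 + q)\<^sup>2 \<le> 0"
      using ineq[of "- d / (1 + q)"] by linarith
    then have "d = 0"
      using \<open>0 \<le> q\<close> by (auto simp: divide_le_0_iff mult_le_0_iff)
    then show ?thesis
      unfolding d_def by (simp add: Re_cinner_commute[of u])
  qed
  then show ?thesis by blast
qed

lemma adj_exists:
  fixes x :: "'h::complex_hilbert_space \<Rightarrow>\<^sub>L 'h"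
  assumes x: "x \<in> bounded_operators"
  shows "\<exists>y. \<forall>u v. cinner (blinfun_apply x u) v = cinner u (blinfun_apply y v)"
proof -
  have ex: "\<exists>w. \<forall>u. cinner (blinfun_apply x u) v = cinner u w" for v
  proof -
    have "bounded_linear (\<lambda>u. Re (cinner (blinfun_apply x u) v))"
    proof
      fix r and a b :: 'h
      show "Re (cinner (blinfun_apply x (a + b)) v)
          = Re (cinner (blinfun_apply x a) v) + Re (cinner (blinfun_apply x b) v)"
        by (simp add: blinfun.add_right cinner_add_left)
      show "Re (cinner (blinfun_apply x (r *\<^sub>R a)) v) = r *\<^sub>R Re (cinner (blinfun_apply x a) v)"
        by (simp add: blinfun.scaleR_right cinner_scaleR_left)
      have "norm (Re (cinner (blinfun_apply x a) v)) \<le> norm a * (norm x * norm v)" for a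
      proof -
        have "\<bar>Re (cinner (blinfun_apply x a) v)\<bar> \<le> norm (blinfun_apply x a) * norm v"
          using Re_cinner_le[of "blinfun_apply x a" v] Re_cinner_le[of "- blinfun_apply x a" v]
          by (simp add: cinner_minus_left abs_le_iff)
        also have "\<dots> \<le> (norm x * norm a) * norm v"
          by (intro mult_right_mono norm_blinfun) simp
        finally show ?thesis by (simp add: mult_ac)
      qed
      then show "\<exists>K. \<forall>a. norm (Re (cinner (blinfun_apply x a) v)) \<le> norm a * K"
        by blast
    qed
    then obtain w where w: "\<And>u. Re (cinner u w) = Re (cinner (blinfun_apply x u) v)"
      using real_riesz[of "\<lambda>u. Re (cinner (blinfun_apply x u) v)"] by blast
    have "Im (cinner u w) = Im (cinner (blinfun_apply x u) v)" for u
      using w[of "\<i> *\<^sub>C u"] x by (simp add: bounded_operators_def cinner_scaleC_left)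
    with w show ?thesis
      by (intro exI[of _ w]) (simp add: complex_eq_iff)
  qed
  then obtain f where f: "\<And>u v. cinner (blinfun_apply x u) v = cinner u (f v)"
    by metis
  have "bounded_linear f"
  proof
    fix r and a b :: 'h
    show "f (a + b) = f a + f b"
      by (intro cinner_eqI) (simp add: f[symmetric] cinner_add_right)
    show "f (r *\<^sub>R a) = r *\<^sub>R f a"
      by (intro cinner_eqI) (simp add: f[symmetric] cinner_scaleR_right)
    have "norm (f a) \<le> norm a * norm x" for a
    proof (cases "norm (f a) = 0")
      case True
      then show ?thesis by simp
    next
      case False
      have "norm (f a) * norm (f a) = Re (cinner (blinfun_apply x (f a)) a)"
        by (simp add: f power2_norm_eq_cinner flip: power2_eq_square)
      also have "\<dots> \<le> norm (blinfun_apply x (f a)) * norm a"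
        by (rule Re_cinner_le)
      also have "\<dots> \<le> (norm x * norm (f a)) * norm a"
        by (intro mult_right_mono norm_blinfun) simp
      finally have "norm (f a) * norm (f a) \<le> (norm a * norm x) * norm (f a)"
        by (simp add: mult_ac)
      then show ?thesis
        using False by simp
    qed
    then show "\<exists>K. \<forall>a. norm (f a) \<le> norm a * K"
      by blast
  qed
  then have "blinfun_apply (Blinfun f) = f"
    by (rule bounded_linear_Blinfun_apply)
  then show ?thesis
    using f by (intro exI[of _ "Blinfun f"]) simp
qed

lemma cinner_adj:
  assumes "x \<in> bounded_operators"
  shows "cinner (blinfun_apply x u) v = cinner u (blinfun_apply (adj x) v)"
  using adj_exists[OF assms] adj_eqI by metis

definition positive_op :: "('h::complex_hilbert_space \<Rightarrow>\<^sub>L 'h) \<Rightarrow> bool"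
  where "positive_op x \<longleftrightarrow> x \<in> bounded_operators \<and> (\<forall>v. cinner (blinfun_apply x v) v \<in> \<real>\<^sub>\<ge>\<^sub>0)"

definition op_le :: "('h::complex_hilbert_space \<Rightarrow>\<^sub>L 'h) \<Rightarrow> ('h \<Rightarrow>\<^sub>L 'h) \<Rightarrow> bool"
  where "op_le x y \<longleftrightarrow> positive_op (y - x)"

section \<open>Von Neumann algebras and their subalgebras\<close>

definition unital_subalgebra :: "('h::complex_hilbert_space \<Rightarrow>\<^sub>L 'h) set \<Rightarrow> bool"
  where "unital_subalgebra A \<longleftrightarrow> A \<subseteq> bounded_operators \<and> cop.subspace A \<and>
    id_blinfun \<in> A \<and> (\<forall>a\<in>A. \<forall>b\<in>A. a o\<^sub>L b \<in> A)"

definition commutant :: "('h::complex_hilbert_space \<Rightarrow>\<^sub>L 'h) set \<Rightarrow> ('h \<Rightarrow>\<^sub>L 'h) set"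
  where "commutant S = {x \<in> bounded_operators. \<forall>s\<in>S. x o\<^sub>L s = s o\<^sub>L x}"

definition von_neumann_algebra :: "('h::complex_hilbert_space \<Rightarrow>\<^sub>L 'h) set \<Rightarrow> bool"
  where "von_neumann_algebra M \<longleftrightarrow>
    unital_subalgebra M \<and> (\<forall>x\<in>M. adj x \<in> M) \<and> commutant (commutant M) = M"

definition finite_dimensional :: "('h::complex_hilbert_space \<Rightarrow>\<^sub>L 'h) set \<Rightarrow> bool"
  where "finite_dimensional V \<longleftrightarrow> (\<exists>B. finite B \<and> V \<subseteq> cop.span B)"

definition invertibles :: "('h::complex_hilbert_space \<Rightarrow>\<^sub>L 'h) set \<Rightarrow> ('h \<Rightarrow>\<^sub>L 'h) set"
  where "invertibles A = {a \<in> A. \<exists>b\<in>A. a o\<^sub>L b = id_blinfun \<and> b o\<^sub>L a = id_blinfun}"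

definition positive_invertibles :: "('h::complex_hilbert_space \<Rightarrow>\<^sub>L 'h) set \<Rightarrow> ('h \<Rightarrow>\<^sub>L 'h) set"
  where "positive_invertibles M = {x \<in> invertibles M. positive_op x}"

text \<open>For a subalgebra \<open>A\<close> of a von Neumann algebra \<open>M\<close> the elements $a^* a$ below lie in
  \<^term>\<open>positive_invertibles M\<close> automatically, so that the inclusion says precisely that they are
  norm dense in it.\<close>

definition logmodular :: "('h::complex_hilbert_space \<Rightarrow>\<^sub>L 'h) set \<Rightarrow> ('h \<Rightarrow>\<^sub>L 'h) set \<Rightarrow> bool"
  where "logmodular M A \<longleftrightarrow>
    positive_invertibles M \<subseteq> closure {adj a o\<^sub>L a | a. a \<in> invertibles A}"

definition projections :: "('h::complex_hilbert_space \<Rightarrow>\<^sub>L 'h) set \<Rightarrow> ('h \<Rightarrow>\<^sub>L 'h) set"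
  where "projections M = {p \<in> M. p o\<^sub>L p = p \<and> adj p = p}"

definition Lat :: "('h::complex_hilbert_space \<Rightarrow>\<^sub>L 'h) set \<Rightarrow> ('h \<Rightarrow>\<^sub>L 'h) set \<Rightarrow> ('h \<Rightarrow>\<^sub>L 'h) set"
  where "Lat M A = {p \<in> projections M. \<forall>a\<in>A. a o\<^sub>L p = p o\<^sub>L a o\<^sub>L p}"

definition Alg :: "('h::complex_hilbert_space \<Rightarrow>\<^sub>L 'h) set \<Rightarrow> ('h \<Rightarrow>\<^sub>L 'h) set \<Rightarrow> ('h \<Rightarrow>\<^sub>L 'h) set"
  where "Alg M E = {x \<in> M. \<forall>p\<in>E. x o\<^sub>L p = p o\<^sub>L x o\<^sub>L p}"

definition reflexive_in :: "('h::complex_hilbert_space \<Rightarrow>\<^sub>L 'h) set \<Rightarrow> ('h \<Rightarrow>\<^sub>L 'h) set \<Rightarrow> bool"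
  where "reflexive_in M A \<longleftrightarrow> A = Alg M (Lat M A)"

text \<open>A totally ordered set of projections is automatically closed under meets and joins (the minimum
  and the maximum of two elements), so the lattice condition on a nest needs no separate clause.\<close>

definition nest_in :: "('h::complex_hilbert_space \<Rightarrow>\<^sub>L 'h) set \<Rightarrow> ('h \<Rightarrow>\<^sub>L 'h) set \<Rightarrow> bool"
  where "nest_in M E \<longleftrightarrow> E \<subseteq> projections M \<and> (\<forall>p\<in>E. \<forall>q\<in>E. op_le p q \<or> op_le q p)"

definition nest_subalgebra :: "('h::complex_hilbert_space \<Rightarrow>\<^sub>L 'h) set \<Rightarrow> ('h \<Rightarrow>\<^sub>L 'h) set \<Rightarrow> bool"
  where "nest_subalgebra M A \<longleftrightarrow> (\<exists>E. nest_in M E \<and> A = Alg M E)"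

end

theory Submission
  imports Defs
begin

text \<open>
  Finite dimension makes logmodularity exact. If $a_n^* a_n$ converges then $(a_n)$ is bounded, so a
  subsequence converges inside \<open>A\<close>; hence every $y^*y$ with \<open>y\<close> in \<open>M\<close> equals $a^*a$ for some \<open>a\<close> in
  \<open>A\<close>. Moreover \<open>a\<close> can be chosen so as to commute with every projection \<open>p\<close> in \<open>Lat M A\<close> that commutes
  with $y^*y$: relative to such a \<open>p\<close> the factor \<open>a\<close> is block upper triangular, and an invertible block
  upper triangular \<open>a\<close> with block diagonal $a^*a$ is block diagonal (lemma \<open>factorization\<close>). This refined
  factorization is the only form in which logmodularity enters the rest of the argument.

  Applied to \<open>p\<close> itself it gives \<open>Lat M A \<subseteq> A\<close> (lemma \<open>Lat_subset\<close>), so the invariant projections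
  commute with each other and are closed under meet and join.

  The heart is the statement that, when \<open>q\<close> covers \<open>p\<close> in \<open>Lat M A\<close>, the whole space
  \<open>q M (q - p)\<close> lies in \<open>A\<close> (lemma \<open>cover_columns\<close>). It suffices to treat \<open>q M r\<close> for a minimal
  projection \<open>r\<close> of \<open>M\<close> below \<open>q - p\<close>. The left \<open>A\<close>-module \<open>Y = A \<inter> q M r\<close> is nonzero, since it
  contains a factor of \<open>r\<close>, and \<open>Y M\<close> is a right ideal \<open>s M\<close> with \<open>s\<close> in \<open>Lat M A\<close>; as \<open>r M r\<close> consists of
  scalars, \<open>s M r \<subseteq> Y\<close>. The cover property makes \<open>q\<close> the join of \<open>p\<close> and \<open>s\<close>, so that \<open>t = q - s\<close> lies
  below \<open>p\<close>. Now \<open>A\<close> has neither a corner from \<open>q - p\<close> to \<open>t\<close> nor one from \<open>t\<close> to \<open>q - p\<close>, and factoring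
  a suitable positive element shows that then \<open>M\<close> has none either (lemma \<open>off_diagonal_vanishes\<close>).
  Therefore \<open>q M r = s M r \<subseteq> A\<close>.

  Finally take a chain of successive covers from \<open>0\<close> to \<open>1\<close>. An element \<open>x\<close> of \<open>M\<close> leaving the chain
  invariant is the sum of the \<open>x (q - p) = q x (q - p)\<close> over its steps, so it lies in \<open>A\<close>. Thus \<open>A\<close> is the
  algebra of this nest, and, the nest being part of \<open>Lat M A\<close>, also the algebra of \<open>Lat M A\<close>.
\<close>


section \<open>The algebra of bounded operators\<close>

notation blinfun_compose (infixl "\<cdot>" 70)

lemma compose_add_left: "(a + b) \<cdot> c = a \<cdot> c + b \<cdot> c"
  and compose_add_right: "a \<cdot> (b + c) = a \<cdot> b + a \<cdot> c"
  and compose_diff_left: "(a - b) \<cdot> c = a \<cdot> c - b \<cdot> c"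
  and compose_diff_right: "a \<cdot> (b - c) = a \<cdot> b - a \<cdot> c"
  and compose_assoc: "a \<cdot> b \<cdot> c = a \<cdot> (b \<cdot> c)"
  by (auto intro!: blinfun_eqI simp: blinfun.bilinear_simps)

lemmas op_algebra = compose_add_left compose_add_right compose_diff_left compose_diff_right
  compose_assoc

lemma compose_id [simp]: "id_blinfun \<cdot> a = a" "a \<cdot> id_blinfun = a"
  by (auto intro!: blinfun_eqI)

lemma compose_zero [simp]: "0 \<cdot> a = 0" "a \<cdot> 0 = 0"
  by (auto intro!: blinfun_eqI)

text \<open>Composites are normalised to right-nested form, where an equation \<open>x \<cdot> y = z\<close> no longer matches inside
  \<open>x \<cdot> (y \<cdot> w)\<close>.\<close>

lemma compose_eq_cong: "x \<cdot> y = z \<Longrightarrow> x \<cdot> (y \<cdot> w) = z \<cdot> w"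
  for x y w :: "'a::real_normed_vector \<Rightarrow>\<^sub>L 'a"
  by (simp flip: compose_assoc)

lemma scale_op_compose_left: "scale_op c a \<cdot> b = scale_op c (a \<cdot> b)"
  by (auto intro!: blinfun_eqI simp: scale_op_apply)

lemma scale_op_compose_right: "a \<in> bounded_operators \<Longrightarrow> a \<cdot> scale_op c b = scale_op c (a \<cdot> b)"
  by (auto intro!: blinfun_eqI simp: scale_op_apply bounded_operators_def)

lemma norm_scale_op_le: "norm (scale_op c x) \<le> cmod c * norm x"
  by (rule norm_blinfun_bound) (auto simp: scale_op_apply norm_scaleC norm_blinfun mult.assoc intro!: mult_left_mono)

lemma norm_scale_op: "norm (scale_op c x) = cmod c * norm x"
proof (cases "c = 0")
  case False
  have "norm x = norm (scale_op (inverse c) (scale_op c x))"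
    using False by simp
  also have "\<dots> \<le> cmod (inverse c) * norm (scale_op c x)"
    by (rule norm_scale_op_le)
  finally have "cmod c * norm x \<le> norm (scale_op c x)"
    using False by (simp add: norm_inverse flip: divide_inverse_commute) (simp add: field_simps norm_divide)
  then show ?thesis
    using norm_scale_op_le[of c x] by simp
qed simp

lemma tendsto_scale_op:
  assumes "(c \<longlongrightarrow> l) F"
  shows "((\<lambda>n. scale_op (c n) b) \<longlongrightarrow> scale_op l b) F"
proof -
  have "((\<lambda>n. cmod (c n - l) * norm b) \<longlongrightarrow> 0 * norm b) F"
    using tendsto_norm_zero[OF LIM_zero[OF assms]] by (rule tendsto_mult_right)
  then have "((\<lambda>n. norm (scale_op (c n) b - scale_op l b)) \<longlongrightarrow> 0) F"
    by (simp add: norm_scale_op flip: cop.scale_left_diff_distrib)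
  then show ?thesis
    by (simp add: tendsto_norm_zero_iff LIM_zero_iff)
qed

lemma scale_op_of_real: "scale_op (complex_of_real r) x = r *\<^sub>R x"
  by (auto intro!: blinfun_eqI simp: scale_op_apply scaleR_scaleC blinfun.bilinear_simps)

lemma bounded_operators_subspace: "cop.subspace bounded_operators"
proof (rule cop.subspaceI)
  have "c *\<^sub>C (0::'a) = 0" for c
    using norm_scaleC[of c "0::'a"] by simp
  then show "0 \<in> (bounded_operators :: ('a \<Rightarrow>\<^sub>L 'a) set)"
    by (simp add: bounded_operators_def)
  show "x + y \<in> bounded_operators" if "x \<in> bounded_operators" "y \<in> bounded_operators" for x y :: "'a \<Rightarrow>\<^sub>L 'a"
    using that by (simp add: bounded_operators_def blinfun.bilinear_simps scaleC_add_right)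
  show "scale_op c x \<in> bounded_operators" if "x \<in> bounded_operators" for x :: "'a \<Rightarrow>\<^sub>L 'a" and c
    using that by (simp add: bounded_operators_def scale_op_apply scaleC_scaleC mult.commute)
qed

lemma adj_bounded:
  assumes "x \<in> bounded_operators"
  shows "adj x \<in> bounded_operators"
  unfolding bounded_operators_def
proof (safe, rule cinner_eqI)
  fix c v u
  show "cinner u (adj x (c *\<^sub>C v)) = cinner u (c *\<^sub>C adj x v)"
    by (simp add: cinner_adj[OF assms, symmetric] cinner_scaleC_right)
qed

lemma adj_adj:
  assumes "x \<in> bounded_operators"
  shows "adj (adj x) = x"
proof (rule adj_eqI)
  fix u v
  show "cinner (adj x u) v = cinner u (x v)"
    by (metis assms cinner_adj cinner_commute)
qed

lemma adj_compose:
  assumes "x \<in> bounded_operators" "y \<in> bounded_operators"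
  shows "adj (x \<cdot> y) = adj y \<cdot> adj x"
  by (rule adj_eqI) (simp add: cinner_adj assms)

lemma adj_add:
  assumes "x \<in> bounded_operators" "y \<in> bounded_operators"
  shows "adj (x + y) = adj x + adj y"
  by (rule adj_eqI)
    (simp add: cinner_adj assms blinfun.bilinear_simps cinner_add_left cinner_add_right)

lemma adj_diff:
  assumes "x \<in> bounded_operators" "y \<in> bounded_operators"
  shows "adj (x - y) = adj x - adj y"
  by (rule adj_eqI)
    (simp add: cinner_adj assms blinfun.bilinear_simps cinner_diff_left cinner_diff_right)

lemma adj_scale_op:
  assumes "x \<in> bounded_operators"
  shows "adj (scale_op c x) = scale_op (cnj c) (adj x)"
  by (rule adj_eqI) (simp add: cinner_adj assms scale_op_apply cinner_scaleC_left cinner_scaleC_right)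

lemma adj_id [simp]: "adj id_blinfun = id_blinfun"
  by (rule adj_eqI) simp

lemma adj_zero [simp]: "adj 0 = 0"
proof (rule adj_eqI)
  fix u v :: 'a
  show "cinner (blinfun_apply 0 u) v = cinner u (blinfun_apply 0 v)"
    using cinner_minus_left[of 0 v] cinner_minus_right[of u 0] by simp
qed

lemma norm_apply_square:
  assumes "x \<in> bounded_operators"
  shows "(norm (x v))\<^sup>2 = Re (cinner v ((adj x \<cdot> x) v))"
  by (simp add: power2_norm_eq_cinner cinner_adj[OF assms])

lemma adj_compose_self_apply:
  assumes "x \<in> bounded_operators"
  shows "cinner ((adj x \<cdot> x) v) v = complex_of_real ((norm (x v))\<^sup>2)"
proof -
  have "cinner (adj x (x v)) v = cinner (x v) (x v)"
    using cinner_adj[OF adj_bounded[OF assms], of "x v" v] by (simp add: adj_adj assms)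
  then show ?thesis
    by (simp add: complex_eq_iff power2_norm_eq_cinner Im_cinner_self)
qed

text \<open>The value of $x^*x$ at \<open>v\<close> determines \<open>norm (x v)\<close>. This lets $x^*$ be cancelled on the left.\<close>

lemma adj_compose_self_eq_0:
  assumes "x \<in> bounded_operators" "adj x \<cdot> x \<cdot> y = 0"
  shows "x \<cdot> y = 0"
proof (rule blinfun_eqI)
  fix v
  have "(adj x \<cdot> x) (y v) = 0"
    using assms(2) by (metis blinfun_apply_blinfun_compose zero_blinfun.rep_eq)
  then have "(norm (x (y v)))\<^sup>2 = Re (cinner (y v) 0)"
    by (simp add: norm_apply_square[OF assms(1)])
  also have "\<dots> = 0"
    using cinner_minus_right[of "y v" 0] by simp
  finally show "(x \<cdot> y) v = blinfun_apply 0 v"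
    by simp
qed

lemma norm_le_of_adj_compose_self:
  assumes "x \<in> bounded_operators"
  shows "(norm x)\<^sup>2 \<le> norm (adj x \<cdot> x)"
proof -
  have "norm (x v) \<le> sqrt (norm (adj x \<cdot> x)) * norm v" for v
  proof -
    have "(norm (x v))\<^sup>2 \<le> norm v * norm ((adj x \<cdot> x) v)"
      unfolding norm_apply_square[OF assms] by (rule Re_cinner_le)
    also have "\<dots> \<le> norm v * (norm (adj x \<cdot> x) * norm v)"
      by (intro mult_left_mono norm_blinfun) simp
    also have "\<dots> = (sqrt (norm (adj x \<cdot> x)) * norm v)\<^sup>2"
      by (simp add: power_mult_distrib power2_eq_square)
    finally show ?thesis
      by (rule power2_le_imp_le) simp
  qed
  then have "norm x \<le> sqrt (norm (adj x \<cdot> x))"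
    by (intro norm_blinfun_bound) auto
  then show ?thesis
    using power_mono[of "norm x" "sqrt (norm (adj x \<cdot> x))" 2] by simp
qed

lemma norm_adj_le:
  assumes "x \<in> bounded_operators"
  shows "norm (adj x) \<le> norm x"
proof -
  have "norm (adj x) * norm (adj x) \<le> norm (x \<cdot> adj x)"
    using norm_le_of_adj_compose_self[OF adj_bounded[OF assms]] by (simp add: adj_adj assms power2_eq_square)
  also have "\<dots> \<le> norm x * norm (adj x)"
    by (rule norm_blinfun_compose)
  finally show ?thesis
    by (cases "norm (adj x) = 0") auto
qed

lemma tendsto_adj:
  assumes "(f \<longlongrightarrow> l) F" "\<And>n. f n \<in> bounded_operators" "l \<in> bounded_operators"
  shows "((\<lambda>n. adj (f n)) \<longlongrightarrow> adj l) F"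
proof (rule LIM_zero_cancel, rule Lim_null_comparison[OF _ tendsto_norm_zero[OF LIM_zero[OF assms(1)]]])
  have "norm (adj (f n) - adj l) \<le> norm (f n - l)" for n
    using norm_adj_le[OF cop.subspace_diff[OF bounded_operators_subspace assms(2) assms(3)]]
    by (simp add: adj_diff assms(2,3))
  then show "\<forall>\<^sub>F n in F. norm (adj (f n) - adj l) \<le> norm (f n - l)"
    by simp
qed

section \<open>Finite dimensional spaces of operators\<close>

lemma finite_dimensional_subset: "finite_dimensional W \<Longrightarrow> V \<subseteq> W \<Longrightarrow> finite_dimensional V"
  unfolding finite_dimensional_def by blast

lemma dim_strict_mono:
  assumes "cop.subspace U" "U \<subset> V" "finite_dimensional V"
  shows "cop.dim U < cop.dim V"
proof -
  obtain T where T: "finite T" "V \<subseteq> cop.span T"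
    using assms(3) unfolding finite_dimensional_def by blast
  obtain B where B: "B \<subseteq> U" "cop.independent B" "U \<subseteq> cop.span B" "card B = cop.dim U"
    by (rule cop.basis_exists)
  obtain C where C: "C \<subseteq> V" "cop.independent C" "V \<subseteq> cop.span C" "card C = cop.dim V"
    by (rule cop.basis_exists)
  obtain v where v: "v \<in> V" "v \<notin> U"
    using assms(2) by blast
  have sp: "cop.span B = U"
    using B assms(1) by (simp add: cop.span_subspace)
  have fin: "finite C" "finite B"
    using cop.independent_span_bound[OF T(1)] B C T assms(2) by (meson order.trans psubset_imp_subset)+
  have "cop.independent (insert v B)"
    using v sp B by (simp add: cop.independent_insert)
  then have "card (insert v B) \<le> card C"
    using cop.independent_span_bound[OF fin(1), of "insert v B"] v B C assms(2) by blast
  moreover have "v \<notin> B"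
    using v B by blast
  ultimately show ?thesis
    using fin B C by simp
qed

text \<open>An injective endomorphism of a finite dimensional space is onto. This is the substitute for inverses
  and for spectral calculus: solving \<open>h \<cdot> x = y\<close> inside a subspace \<open>V\<close> gives support projections, inverses
  in \<open>M\<close>, and membership in \<open>A\<close>.\<close>

lemma injective_left_mult_surj:
  assumes V: "cop.subspace V" "finite_dimensional V"
    and h: "h \<in> bounded_operators" "\<And>x. x \<in> V \<Longrightarrow> h \<cdot> x \<in> V"
    and inj: "\<And>x. x \<in> V \<Longrightarrow> h \<cdot> x = 0 \<Longrightarrow> x = 0"
    and y: "y \<in> V"
  shows "\<exists>x\<in>V. h \<cdot> x = y"
proof -
  define W where "W = (\<lambda>x. h \<cdot> x) ` V"
  interpret vp: vector_space_pair "scale_op :: complex \<Rightarrow> ('a \<Rightarrow>\<^sub>L 'a) \<Rightarrow> _" "scale_op :: complex \<Rightarrow> ('a \<Rightarrow>\<^sub>L 'a) \<Rightarrow> _" ..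
  have lin: "Vector_Spaces.linear scale_op scale_op (\<lambda>x. h \<cdot> x)"
    by unfold_locales (auto simp: compose_add_right scale_op_compose_right h)
  obtain T where T: "finite T" "V \<subseteq> cop.span T"
    using V(2) unfolding finite_dimensional_def by blast
  obtain B where B: "B \<subseteq> V" "cop.independent B" "V \<subseteq> cop.span B"
    by (rule cop.maximal_independent_subset)
  have sp: "cop.span B = V"
    using B V by (simp add: cop.span_subspace)
  have fin: "finite B"
    using cop.independent_span_bound[OF T(1)] B T by blast
  have injV: "inj_on (\<lambda>x. h \<cdot> x) V"
  proof (rule inj_onI)
    fix a b assume "a \<in> V" "b \<in> V" "h \<cdot> a = h \<cdot> b"
    then have "a - b = 0"
      using V by (intro inj[of "a - b"]) (simp_all add: cop.subspace_diff compose_diff_right)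
    then show "a = b" by simp
  qed
  have ind: "cop.independent ((\<lambda>x. h \<cdot> x) ` B)"
    using vp.linear_independent_injective_image[OF lin B(2)] injV sp by simp
  have cardB: "card ((\<lambda>x. h \<cdot> x) ` B) = card B"
    using injV B(1) by (intro card_image) (rule inj_on_subset)
  have "y \<in> cop.span ((\<lambda>x. h \<cdot> x) ` B)"
  proof (rule ccontr)
    assume n: "y \<notin> cop.span ((\<lambda>x. h \<cdot> x) ` B)"
    then have "cop.independent (insert y ((\<lambda>x. h \<cdot> x) ` B))"
      using ind by (simp add: cop.independent_insert)
    moreover have "insert y ((\<lambda>x. h \<cdot> x) ` B) \<subseteq> cop.span B"
      using sp y B h by auto
    ultimately have "card (insert y ((\<lambda>x. h \<cdot> x) ` B)) \<le> card B"
      using cop.independent_span_bound[OF fin] by blast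
    moreover have "y \<notin> (\<lambda>x. h \<cdot> x) ` B"
      using n cop.span_base by blast
    ultimately show False
      using fin cardB by simp
  qed
  then show ?thesis
    using vp.linear_span_image[OF lin, of B] sp by auto
qed

text \<open>Induction on the spanning set: a vector \<open>b\<close> outside the span has positive distance from the closed space spanned so
  far, which bounds the coefficients of \<open>b\<close>; Bolzano--Weierstrass for these complex numbers then leaves a
  bounded sequence in the smaller span.\<close>

lemma bounded_seq_in_span_convergent:
  fixes x :: "nat \<Rightarrow> ('h::complex_hilbert_space \<Rightarrow>\<^sub>L 'h)"
  assumes "finite B" "\<And>n. x n \<in> cop.span B" "\<And>n. norm (x n) \<le> K"
  shows "\<exists>l\<in>cop.span B. \<exists>r. strict_mono r \<and> (x \<circ> r) \<longlonglongrightarrow> l"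
  using assms
proof (induction B arbitrary: x K rule: finite_induct)
  case empty
  then have "x = (\<lambda>_. 0)" by auto
  then show ?case
    by (auto intro!: exI[of _ id] simp: strict_mono_id o_def)
next
  case (insert b B)
  show ?case
  proof (cases "b \<in> cop.span B")
    case True
    then have "cop.span (insert b B) = cop.span B"
      by (rule cop.span_redundant)
    then show ?thesis
      using insert.IH[of x K] insert.prems by simp
  next
    case False
    have "closed (cop.span B)"
      unfolding closed_sequential_limits
    proof (intro allI impI)
      fix y l assume y: "(\<forall>n. y n \<in> cop.span B) \<and> y \<longlonglongrightarrow> l"
      then obtain K' where "\<And>n. norm (y n) \<le> K'"
        using convergent_imp_Bseq[of y] unfolding convergent_def Bseq_def by blast
      then obtain l' r where l': "l' \<in> cop.span B" "strict_mono r" "(y \<circ> r) \<longlonglongrightarrow> l'"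
        using insert.IH[of y K'] y by blast
      then have "l = l'"
        using y LIMSEQ_subseq_LIMSEQ LIMSEQ_unique by blast
      then show "l \<in> cop.span B"
        using l' by simp
    qed
    moreover have "cop.span B \<noteq> {}"
      using cop.span_zero by blast
    ultimately have pos: "0 < infdist b (cop.span B)"
      using False in_closed_iff_infdist_zero[of "cop.span B" b] infdist_nonneg[of b "cop.span B"]
      by (simp add: less_le)
    define \<delta> where "\<delta> = infdist b (cop.span B)"
    have far: "cmod c * \<delta> \<le> norm (scale_op c b + y)" if "y \<in> cop.span B" for c y
    proof (cases "c = 0")
      case False
      have "- scale_op (inverse c) y \<in> cop.span B"
        using that by (intro cop.span_neg cop.span_scale)
      then have "\<delta> \<le> norm (b + scale_op (inverse c) y)"
        unfolding \<delta>_def using infdist_le[of "- scale_op (inverse c) y" "cop.span B" b] by (simp add: dist_norm)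
      then have "cmod c * \<delta> \<le> norm (scale_op c (b + scale_op (inverse c) y))"
        by (simp add: norm_scale_op mult_left_mono)
      then show ?thesis
        using False by (simp add: cop.scale_right_distrib)
    qed simp
    have "\<exists>c. x n - scale_op c b \<in> cop.span B" for n
      using insert.prems(1)[of n] by (simp add: cop.span_breakdown_eq)
    then obtain c where c: "\<And>n. x n - scale_op (c n) b \<in> cop.span B"
      by metis
    have c_bd: "cmod (c n) \<le> K / \<delta>" for n
    proof -
      have "cmod (c n) * \<delta> \<le> norm (x n)"
        using far[OF c, of "c n" n] by simp
      also have "\<dots> \<le> K" by (rule insert.prems)
      finally show ?thesis
        using pos by (simp add: \<delta>_def field_simps)
    qed
    then have "bounded (range c)"
      unfolding bounded_iff by blast
    then obtain c0 r where r: "strict_mono r" "(c \<circ> r) \<longlonglongrightarrow> c0"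
      using bounded_imp_convergent_subsequence by blast
    define y where "y n = x (r n) - scale_op (c (r n)) b" for n
    have "norm (y n) \<le> K + K / \<delta> * norm b" for n
    proof -
      have "norm (y n) \<le> norm (x (r n)) + norm (scale_op (c (r n)) b)"
        unfolding y_def by (rule norm_triangle_ineq4)
      also have "\<dots> \<le> K + K / \<delta> * norm b"
        unfolding norm_scale_op by (intro add_mono mult_right_mono insert.prems c_bd) simp
      finally show ?thesis .
    qed
    then obtain l r' where l: "l \<in> cop.span B" "strict_mono r'" "(y \<circ> r') \<longlonglongrightarrow> l"
      using insert.IH[of y] c unfolding y_def by blast
    have "(\<lambda>n. scale_op (c (r (r' n))) b) \<longlonglongrightarrow> scale_op c0 b"
      using LIMSEQ_subseq_LIMSEQ[OF r(2) l(2)] by (intro tendsto_scale_op) (simp add: o_def)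
    then have "(\<lambda>n. scale_op (c (r (r' n))) b + y (r' n)) \<longlonglongrightarrow> scale_op c0 b + l"
      using l(3) by (intro tendsto_add) (simp_all add: o_def)
    then have "(x \<circ> (r \<circ> r')) \<longlonglongrightarrow> scale_op c0 b + l"
      by (simp add: y_def o_def)
    moreover have "scale_op c0 b + l \<in> cop.span (insert b B)"
      using l(1) unfolding cop.span_breakdown_eq by (intro exI[of _ c0]) simp
    moreover have "strict_mono (r \<circ> r')"
      using r l strict_mono_o by blast
    ultimately show ?thesis
      by blast
  qed
qed

lemma bounded_seq_convergent:
  fixes x :: "nat \<Rightarrow> ('h::complex_hilbert_space \<Rightarrow>\<^sub>L 'h)"
  assumes "cop.subspace V" "finite_dimensional V" "\<And>n. x n \<in> V" "\<And>n. norm (x n) \<le> K"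
  obtains l r where "l \<in> V" "strict_mono r" "(x \<circ> r) \<longlonglongrightarrow> l"
proof -
  obtain T where T: "finite T" "V \<subseteq> cop.span T"
    using assms(2) unfolding finite_dimensional_def by blast
  obtain B where B: "B \<subseteq> V" "cop.independent B" "V \<subseteq> cop.span B"
    by (rule cop.maximal_independent_subset)
  have sp: "cop.span B = V"
    using B assms by (simp add: cop.span_subspace)
  have "finite B"
    using cop.independent_span_bound[OF T(1)] B T by blast
  then show ?thesis
    using bounded_seq_in_span_convergent[of B x K] sp assms that by auto
qed

lemma subspace_right_mult_vimage:
  "cop.subspace W \<Longrightarrow> cop.subspace {z. z \<cdot> m \<in> W}"
  by (rule cop.subspaceI)
    (auto simp: cop.subspace_0 cop.subspace_add cop.subspace_scale compose_add_left scale_op_compose_left)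

lemma subspace_left_mult_vimage:
  "cop.subspace W \<Longrightarrow> b \<in> bounded_operators \<Longrightarrow> cop.subspace {z. b \<cdot> z \<in> W}"
  by (rule cop.subspaceI)
    (auto simp: cop.subspace_0 cop.subspace_add cop.subspace_scale compose_add_right scale_op_compose_right)

section \<open>Projections in a finite dimensional star algebra\<close>

locale finite_dim_star_algebra =
  fixes M :: "('h::complex_hilbert_space \<Rightarrow>\<^sub>L 'h) set"
  assumes unital: "unital_subalgebra M"
    and adj_closed: "x \<in> M \<Longrightarrow> adj x \<in> M"
    and finite_dim: "finite_dimensional M"
begin

lemma bounded_of_mem: "x \<in> M \<Longrightarrow> x \<in> bounded_operators"
  and id_mem: "id_blinfun \<in> M"
  and compose_mem: "x \<in> M \<Longrightarrow> y \<in> M \<Longrightarrow> x \<cdot> y \<in> M"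
  and subspace_M: "cop.subspace M"
  using unital unfolding unital_subalgebra_def by auto

lemma add_mem: "x \<in> M \<Longrightarrow> y \<in> M \<Longrightarrow> x + y \<in> M"
  and diff_mem: "x \<in> M \<Longrightarrow> y \<in> M \<Longrightarrow> x - y \<in> M"
  and scale_mem: "x \<in> M \<Longrightarrow> scale_op c x \<in> M"
  and zero_mem: "0 \<in> M"
  using subspace_M by (auto intro: cop.subspace_add cop.subspace_diff cop.subspace_scale cop.subspace_0)

lemmas mem_simps = id_mem compose_mem add_mem diff_mem scale_mem zero_mem adj_closed

lemma projectionD:
  assumes "p \<in> projections M"
  shows "p \<in> M" "p \<cdot> p = p" "adj p = p"
  using assms unfolding projections_def by auto

lemma projectionI: "p \<in> M \<Longrightarrow> p \<cdot> p = p \<Longrightarrow> adj p = p \<Longrightarrow> p \<in> projections M"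
  unfolding projections_def by auto

lemma zero_projection: "0 \<in> projections M"
  by (intro projectionI) (auto simp: zero_mem)

lemma id_projection: "id_blinfun \<in> projections M"
  by (intro projectionI) (auto simp: id_mem)

lemma adj_compose_M: "x \<in> M \<Longrightarrow> y \<in> M \<Longrightarrow> adj (x \<cdot> y) = adj y \<cdot> adj x"
  and adj_add_M: "x \<in> M \<Longrightarrow> y \<in> M \<Longrightarrow> adj (x + y) = adj x + adj y"
  and adj_diff_M: "x \<in> M \<Longrightarrow> y \<in> M \<Longrightarrow> adj (x - y) = adj x - adj y"
  and adj_scale_M: "x \<in> M \<Longrightarrow> adj (scale_op c x) = scale_op (cnj c) (adj x)"
  and adj_adj_M: "x \<in> M \<Longrightarrow> adj (adj x) = x"
  by (simp_all add: adj_compose adj_add adj_diff adj_scale_op adj_adj bounded_of_mem)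

lemmas adj_M = adj_compose_M adj_add_M adj_diff_M adj_scale_M adj_adj_M

lemma projection_le_commute:
  assumes "p \<in> projections M" "q \<in> projections M" "q \<cdot> p = p"
  shows "p \<cdot> q = p"
  using arg_cong[OF assms(3), of adj] assms(1,2) by (simp add: adj_M projectionD)

lemma projection_diff:
  assumes "p \<in> projections M" "q \<in> projections M" "q \<cdot> p = p"
  shows "q - p \<in> projections M"
  using assms projection_le_commute[OF assms]
  by (intro projectionI) (simp_all add: projectionD mem_simps adj_M op_algebra)

lemma projection_add:
  assumes "p \<in> projections M" "q \<in> projections M" "q \<cdot> p = 0"
  shows "q + p \<in> projections M"
proof -
  have "p \<cdot> q = 0"
    using arg_cong[OF assms(3), of adj] assms(1,2) by (simp add: adj_M projectionD)
  then show ?thesis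
    using assms by (intro projectionI) (simp_all add: projectionD mem_simps adj_M op_algebra)
qed

text \<open>A measure of the size of a projection that is finite even when the Hilbert space, and with it the
  range of the projection, is infinite dimensional.\<close>

definition range_dim :: "('h \<Rightarrow>\<^sub>L 'h) \<Rightarrow> nat"
  where "range_dim p = cop.dim {x \<in> M. p \<cdot> x = x}"

lemma subspace_fixed: "p \<in> M \<Longrightarrow> cop.subspace {x \<in> M. p \<cdot> x = x}"
  by (rule cop.subspaceI)
    (auto simp: mem_simps compose_add_right scale_op_compose_right bounded_of_mem)

lemma range_dim_less:
  assumes "p \<in> projections M" "q \<in> projections M" "q \<cdot> p = p" "p \<noteq> q"
  shows "range_dim p < range_dim q"
  unfolding range_dim_def
proof (rule dim_strict_mono)
  show "cop.subspace {x \<in> M. p \<cdot> x = x}"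
    using assms by (intro subspace_fixed projectionD)
  show "finite_dimensional {x \<in> M. q \<cdot> x = x}"
    using finite_dim by (rule finite_dimensional_subset) auto
  have "q \<cdot> x = x" if "p \<cdot> x = x" for x :: "'h \<Rightarrow>\<^sub>L 'h"
    using that compose_eq_cong[OF assms(3), of x] by simp
  moreover have "p \<cdot> q \<noteq> q"
    using projection_le_commute[OF assms(1-3)] assms(4) by simp
  ultimately show "{x \<in> M. p \<cdot> x = x} \<subset> {x \<in> M. q \<cdot> x = x}"
    using projectionD[OF assms(2)] by blast
qed

lemma range_dim_le:
  obtains N where "\<And>p. range_dim p \<le> N"
proof -
  obtain T where "finite T" "M \<subseteq> cop.span T"
    using finite_dim unfolding finite_dimensional_def by blast
  then have "range_dim p \<le> card T" for p
    unfolding range_dim_def by (intro cop.dim_le_card) auto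
  then show ?thesis using that by blast
qed

lemma adj_compose_self_cancel:
  assumes "x \<in> M" "adj x \<cdot> x \<cdot> y = 0"
  shows "x \<cdot> y = 0"
  using adj_compose_self_eq_0 assms bounded_of_mem by blast

text \<open>Left multiplication by \<open>k\<close> is injective on the right ideal \<open>k M\<close>, because $k^*k m = 0$ forces \<open>k m = 0\<close>.
  So \<open>k \<cdot> s = k\<close> has a solution \<open>s = k \<cdot> m\<close> in that ideal, and $s^*s = s^*k m = k m = s$ makes it a
  projection.\<close>

lemma self_adjoint_support:
  assumes k: "k \<in> M" "adj k = k"
  obtains s m where "s \<in> projections M" "m \<in> M" "s = k \<cdot> m" "k \<cdot> s = k" "s \<cdot> k = k"
proof -
  define V where "V = (\<lambda>m. k \<cdot> m) ` M"
  have VM: "V \<subseteq> M"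
    unfolding V_def using k by (auto simp: mem_simps)
  have "cop.subspace V"
    unfolding V_def
  proof (rule cop.subspaceI)
    show "0 \<in> (\<cdot>) k ` M"
      using zero_mem by force
    show "x + y \<in> (\<cdot>) k ` M" if "x \<in> (\<cdot>) k ` M" "y \<in> (\<cdot>) k ` M" for x y
      using that add_mem by (force simp flip: compose_add_right)
    show "scale_op c x \<in> (\<cdot>) k ` M" if "x \<in> (\<cdot>) k ` M" for c x
      using that scale_mem k by (force simp: bounded_of_mem simp flip: scale_op_compose_right)
  qed
  moreover have "finite_dimensional V"
    using finite_dim VM by (rule finite_dimensional_subset)
  moreover have "k \<cdot> x \<in> V" if "x \<in> V" for x
    using that VM unfolding V_def by blast
  moreover have "x = 0" if x: "x \<in> V" "k \<cdot> x = 0" for x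
  proof -
    obtain m where "m \<in> M" "x = k \<cdot> m"
      using x unfolding V_def by blast
    then show "x = 0"
      using adj_compose_self_cancel[OF k(1), of m] x k by (simp add: compose_assoc)
  qed
  moreover have "k \<in> V"
    unfolding V_def using id_mem by force
  ultimately have "\<exists>s\<in>V. k \<cdot> s = k"
    by (intro injective_left_mult_surj[of V k k] bounded_of_mem k) auto
  then obtain s m where sm: "m \<in> M" "s = k \<cdot> m" "k \<cdot> s = k"
    unfolding V_def by blast
  then have sM: "s \<in> M"
    using k by (simp add: mem_simps)
  have sk: "adj s \<cdot> k = k"
    using arg_cong[OF sm(3), of adj] k sM by (simp add: adj_M)
  have ss: "adj s \<cdot> s = s"
    unfolding sm(2) using compose_eq_cong[OF sk, of m] sm(2) by simp
  have "adj s = adj s \<cdot> s"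
    using arg_cong[OF ss, of adj] sM by (simp add: adj_M mem_simps)
  then have "adj s = s"
    using ss by simp
  then have "s \<in> projections M"
    using ss sM by (intro projectionI) auto
  then show ?thesis
    using that sm sk \<open>adj s = s\<close> by auto
qed

text \<open>Every right ideal of \<open>M\<close> is generated by a projection: were the largest projection \<open>s\<close> in \<open>J\<close> not a
  left unit, the support of $y y^*$ for some \<open>y = x - s \<cdot> x\<close> would be orthogonal to \<open>s\<close> and could be added
  to it.\<close>

lemma right_ideal_projection:
  assumes J: "J \<subseteq> M" "cop.subspace J" "\<And>x m. x \<in> J \<Longrightarrow> m \<in> M \<Longrightarrow> x \<cdot> m \<in> J"
  obtains s where "s \<in> projections M" "s \<in> J" "\<And>x. x \<in> J \<Longrightarrow> s \<cdot> x = x"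
proof -
  let ?P = "\<lambda>s. s \<in> projections M \<and> s \<in> J"
  obtain N where N: "\<And>p. range_dim p \<le> N"
    by (rule range_dim_le) blast
  have "?P 0"
    using zero_projection cop.subspace_0[OF J(2)] by blast
  then have "\<exists>s. ?P s \<and> (\<forall>u. ?P u \<longrightarrow> range_dim u \<le> range_dim s)"
    by (rule ex_has_greatest_nat[of ?P 0 range_dim "Suc N"]) (simp add: N less_Suc_eq_le)
  then obtain s where s: "?P s" "\<And>u. ?P u \<Longrightarrow> range_dim u \<le> range_dim s"
    by auto
  have "s \<cdot> x = x" if x: "x \<in> J" for x
  proof (rule ccontr)
    assume ne: "s \<cdot> x \<noteq> x"
    have sM: "s \<in> M" and xM: "x \<in> M"
      using s J x by auto
    define y where "y = x - s \<cdot> x"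
    have y: "y \<in> J" "y \<in> M" "s \<cdot> y = 0" "y \<noteq> 0"
      using s x xM J ne by (auto simp: y_def projectionD op_algebra compose_eq_cong[OF projectionD(2)] cop.subspace_diff)
    define k where "k = y \<cdot> adj y"
    have k: "k \<in> J" "k \<in> M" "adj k = k"
      using y J(3) by (auto simp: k_def mem_simps adj_M)
    have "adj y \<noteq> 0"
      using y adj_adj_M[of y] by auto
    then have "k \<noteq> 0"
      using adj_compose_self_cancel[of "adj y" id_blinfun] y by (auto simp: k_def adj_M mem_simps)
    obtain s' m where s': "s' \<in> projections M" "m \<in> M" "s' = k \<cdot> m" "k \<cdot> s' = k"
      using self_adjoint_support[OF k(2,3)] by metis
    have "s' \<in> J" "s' \<noteq> 0"
      using s' k J(3) \<open>k \<noteq> 0\<close> by auto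
    have ss': "s \<cdot> s' = 0"
      by (simp add: s'(3) k_def compose_assoc compose_eq_cong[OF y(3)])
    have s's: "s' \<cdot> s = 0"
      using arg_cong[OF ss', of adj] s(1) s'(1) by (simp add: adj_M projectionD)
    have u: "s + s' \<in> projections M"
      using s(1) s'(1) ss' by (intro projection_add) auto
    have "s + s' \<in> J"
      using s \<open>s' \<in> J\<close> J(2) by (simp add: cop.subspace_add)
    then have "range_dim (s + s') \<le> range_dim s"
      using s u by blast
    moreover have "range_dim s < range_dim (s + s')"
      using s(1) u s's \<open>s' \<noteq> 0\<close> by (intro range_dim_less) (auto simp: op_algebra projectionD)
    ultimately show False by simp
  qed
  then show ?thesis
    using that s by blast
qed

definition minimal_projection :: "('h \<Rightarrow>\<^sub>L 'h) \<Rightarrow> bool"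
  where "minimal_projection r \<longleftrightarrow> r \<in> projections M \<and> r \<noteq> 0 \<and>
    (\<forall>s\<in>projections M. r \<cdot> s = s \<longrightarrow> s = 0 \<or> s = r)"

lemma minimal_projection_below:
  assumes "d \<in> projections M" "d \<noteq> 0"
  obtains r where "minimal_projection r" "d \<cdot> r = r"
proof -
  let ?P = "\<lambda>r. r \<in> projections M \<and> r \<noteq> 0 \<and> d \<cdot> r = r"
  have "?P d"
    using assms by (auto simp: projectionD)
  then have "\<exists>r. ?P r \<and> (\<forall>s. ?P s \<longrightarrow> range_dim r \<le> range_dim s)"
    by (rule ex_has_least_nat)
  then obtain r where r: "?P r" "\<And>s. ?P s \<Longrightarrow> range_dim r \<le> range_dim s"
    by auto
  have "s = 0 \<or> s = r" if s: "s \<in> projections M" "r \<cdot> s = s" for s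
  proof (rule ccontr)
    assume "\<not> (s = 0 \<or> s = r)"
    moreover have "d \<cdot> s = s"
      using compose_eq_cong[of d r r s] r s by simp
    ultimately show False
      using r(2)[of s] range_dim_less[of s r] s r(1) by auto
  qed
  then show ?thesis
    using that r unfolding minimal_projection_def by blast
qed

text \<open>If \<open>k = \<parallel>z\<parallel>\<^sup>2 r - z\<^sup>* z\<close> is nonzero, its support projection must be \<open>r\<close> by minimality, so \<open>k\<close> is bounded
  below on the range of \<open>r\<close>. But \<open>norm (k v)\<close> is small when \<open>norm (z v)\<close> is close to \<open>norm z * norm v\<close>, and
  such \<open>v\<close> exist by definition of the operator norm.\<close>

lemma minimal_projection_square:
  assumes r: "minimal_projection r" and z: "z \<in> M" "z \<cdot> r = z"
  shows "adj z \<cdot> z = scale_op (complex_of_real ((norm z)\<^sup>2)) r"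
proof (rule ccontr)
  assume ne: "adj z \<cdot> z \<noteq> scale_op (complex_of_real ((norm z)\<^sup>2)) r"
  define h where "h = adj z \<cdot> z"
  define \<tau> where "\<tau> = (norm z)\<^sup>2"
  define k where "k = scale_op (complex_of_real \<tau>) r - h"
  have rM: "r \<in> projections M" "r \<in> M" "r \<cdot> r = r" "adj r = r"
    using r unfolding minimal_projection_def by (auto simp: projectionD)
  have "r \<cdot> adj z = adj (z \<cdot> r)"
    using rM z(1) by (simp add: adj_M)
  then have "r \<cdot> adj z = adj z"
    using z(2) by simp
  then have rh: "r \<cdot> h = h"
    unfolding h_def by (rule compose_eq_cong)
  have hM: "h \<in> M" "adj h = h"
    unfolding h_def using z by (simp_all add: mem_simps adj_M)
  have k: "k \<in> M" "adj k = k" "k \<noteq> 0" "r \<cdot> k = k"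
    using ne hM rM rh
    by (auto simp: k_def mem_simps adj_M compose_diff_right scale_op_compose_right bounded_of_mem)
      (simp add: h_def \<tau>_def)
  obtain s m where s: "s \<in> projections M" "m \<in> M" "s = k \<cdot> m" "k \<cdot> s = k"
    using self_adjoint_support[OF k(1,2)] by metis
  have "r \<cdot> s = s"
    unfolding s(3) using k(4) by (rule compose_eq_cong)
  moreover have "s \<noteq> 0"
    using s k by auto
  ultimately have "s = r"
    using r s unfolding minimal_projection_def by blast
  then have "adj r = adj (k \<cdot> m)"
    using s by simp
  then have r_eq: "r = adj m \<cdot> k"
    using rM k s(2) by (simp add: adj_M)
  define C where "C = norm (adj m)"
  have zpos: "0 < norm z"
  proof (rule ccontr)
    assume "\<not> 0 < norm z"
    then have "z = 0" by simp
    then show False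
      using ne by simp
  qed
  then have lpos: "0 < \<tau>" by (simp add: \<tau>_def)
  have rnz: "r \<noteq> 0"
    using r unfolding minimal_projection_def by simp
  then have Cpos: "0 < C"
    using r_eq by (auto simp: C_def)
  \<comment> \<open>Expand \<open>norm (k v)\<close> and compare with \<open>norm v \<le> C * norm (k v)\<close>: on the range of \<open>r\<close>, the norm of \<open>z\<close>
    stays strictly below its norm on the whole space.\<close>
  have bound: "(norm (z v))\<^sup>2 \<le> (\<tau> - 1 / (2 * \<tau> * C\<^sup>2)) * (norm v)\<^sup>2" if v: "r v = v" for v
  proof -
    have kv: "k v = \<tau> *\<^sub>R v - h v"
      using v by (simp add: k_def scale_op_of_real blinfun.bilinear_simps)
    have "v = adj m (k v)"
      using v r_eq by (metis blinfun_apply_blinfun_compose)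
    then have "norm v \<le> C * norm (k v)"
      unfolding C_def by (metis norm_blinfun)
    then have 1: "(norm v)\<^sup>2 \<le> C\<^sup>2 * (norm (k v))\<^sup>2"
      by (metis norm_ge_zero power_mono power_mult_distrib)
    have "norm (h v) \<le> norm (adj z) * norm (z v)"
      by (simp add: h_def norm_blinfun)
    also have "\<dots> \<le> norm z * (norm z * norm v)"
      by (intro mult_mono norm_blinfun norm_adj_le bounded_of_mem z) auto
    finally have "norm (h v) \<le> \<tau> * norm v"
      by (simp add: \<tau>_def power2_eq_square mult.assoc)
    then have hv: "(norm (h v))\<^sup>2 \<le> \<tau>\<^sup>2 * (norm v)\<^sup>2"
      by (metis norm_ge_zero power_mono power_mult_distrib)
    have "Re (cinner v (h v)) = (norm (z v))\<^sup>2"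
      using norm_apply_square[OF bounded_of_mem[OF z(1)], of v] by (simp add: h_def)
    then have "(norm (k v))\<^sup>2 = \<tau>\<^sup>2 * (norm v)\<^sup>2 - 2 * \<tau> * (norm (z v))\<^sup>2 + (norm (h v))\<^sup>2"
      unfolding kv norm_diff_square cinner_scaleR_left by (simp add: power_mult_distrib)
    then have "(norm (k v))\<^sup>2 \<le> 2 * \<tau> * (\<tau> * (norm v)\<^sup>2 - (norm (z v))\<^sup>2)"
      using hv by (simp add: power2_eq_square algebra_simps)
    then have "C\<^sup>2 * (norm (k v))\<^sup>2 \<le> C\<^sup>2 * (2 * \<tau> * (\<tau> * (norm v)\<^sup>2 - (norm (z v))\<^sup>2))"
      by (intro mult_left_mono) auto
    with 1 have "(norm v)\<^sup>2 \<le> (2 * \<tau> * C\<^sup>2) * (\<tau> * (norm v)\<^sup>2 - (norm (z v))\<^sup>2)"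
      by (simp add: algebra_simps)
    then have "(norm v)\<^sup>2 / (2 * \<tau> * C\<^sup>2) \<le> \<tau> * (norm v)\<^sup>2 - (norm (z v))\<^sup>2"
      using lpos Cpos by (simp add: pos_divide_le_eq mult_ac)
    then show ?thesis
      by (simp add: algebra_simps)
  qed
  have "\<exists>v. r v \<noteq> 0"
    using rnz by (metis blinfun_eqI zero_blinfun.rep_eq)
  then obtain v0 where v0: "r v0 \<noteq> 0" by blast
  have rr: "r (r v) = r v" for v
    using rM(3) by (metis blinfun_apply_blinfun_compose)
  define \<mu> where "\<mu> = \<tau> - 1 / (2 * \<tau> * C\<^sup>2)"
  have "0 \<le> \<mu> * (norm (r v0))\<^sup>2"
    using bound[OF rr, of v0] zero_le_power2 order_trans unfolding \<mu>_def by blast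
  then have mu: "0 \<le> \<mu>"
    using v0 by (simp add: zero_le_mult_iff)
  have nr: "norm (r v) \<le> norm v" for v
  proof -
    have "(norm (r v))\<^sup>2 = Re (cinner v (r v))"
      using norm_apply_square[OF bounded_of_mem[OF rM(2)], of v] rM by simp
    also have "\<dots> \<le> norm v * norm (r v)"
      by (rule Re_cinner_le)
    finally show ?thesis
      by (cases "norm (r v) = 0") (auto simp: power2_eq_square)
  qed
  have "norm z \<le> sqrt \<mu>"
  proof (rule norm_blinfun_bound)
    fix v
    have "z v = z (r v)"
      using z(2) by (metis blinfun_apply_blinfun_compose)
    then have "(norm (z v))\<^sup>2 \<le> \<mu> * (norm (r v))\<^sup>2"
      using bound[OF rr, of v] by (simp add: \<mu>_def)
    also have "\<dots> \<le> \<mu> * (norm v)\<^sup>2"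
      by (intro mult_left_mono power_mono nr mu) simp
    also have "\<dots> = (sqrt \<mu> * norm v)\<^sup>2"
      using mu by (simp add: power_mult_distrib)
    finally show "norm (z v) \<le> sqrt \<mu> * norm v"
      by (rule power2_le_imp_le) (simp add: mu)
  qed (simp add: mu)
  then have "\<tau> \<le> (sqrt \<mu>)\<^sup>2"
    unfolding \<tau>_def by (intro power_mono) auto
  then have "\<tau> \<le> \<mu>"
    using mu by simp
  moreover have "0 < 1 / (2 * \<tau> * C\<^sup>2)"
    using lpos Cpos by simp
  ultimately show False
    unfolding \<mu>_def by linarith
qed

text \<open>The corner \<open>r M r\<close> consists of scalars. The preceding lemma, applied to \<open>w\<close> and to \<open>w + r\<close>, shows that
  $w + w^*$ is a multiple of \<open>r\<close>; doing the same for \<open>\<i> w\<close> isolates \<open>w\<close>.\<close>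

lemma minimal_projection_corner:
  assumes r: "minimal_projection r" and y: "y \<in> M"
  obtains c where "r \<cdot> y \<cdot> r = scale_op c r"
proof -
  have rM: "r \<in> M" "r \<cdot> r = r" "adj r = r"
    using r unfolding minimal_projection_def by (auto simp: projectionD)
  have real_part: "\<exists>c. w + adj w = scale_op c r" if w: "w \<in> M" "r \<cdot> w = w" "w \<cdot> r = w" for w
  proof -
    obtain c1 c2 where
      c1: "adj (w + r) \<cdot> (w + r) = scale_op c1 r" and
      c2: "adj w \<cdot> w = scale_op c2 r"
      using minimal_projection_square[OF r, of "w + r"] minimal_projection_square[OF r, of w] w rM
      by (simp add: mem_simps op_algebra) metis
    have "adj w \<cdot> r = adj w"
      using arg_cong[OF w(2), of adj] w(1) rM by (simp add: adj_M)
    then have "adj (w + r) \<cdot> (w + r) = adj w \<cdot> w + (w + adj w) + r"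
      using w rM by (simp add: adj_M op_algebra algebra_simps)
    then have "w + adj w = scale_op c1 r - scale_op c2 r - scale_op 1 r"
      using c1 c2 by (simp add: algebra_simps)
    then show ?thesis
      by (metis cop.scale_left_diff_distrib)
  qed
  define w where "w = r \<cdot> y \<cdot> r"
  have w: "w \<in> M" "r \<cdot> w = w" "w \<cdot> r = w"
    using y rM by (simp_all add: w_def mem_simps compose_assoc compose_eq_cong[OF rM(2)])
  obtain a where a: "w + adj w = scale_op a r"
    using real_part[OF w] by blast
  have "\<exists>b. scale_op \<i> w + adj (scale_op \<i> w) = scale_op b r"
    using w rM
    by (intro real_part) (auto simp: mem_simps scale_op_compose_left scale_op_compose_right bounded_of_mem)
  then obtain b where b: "scale_op \<i> w - scale_op \<i> (adj w) = scale_op b r"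
    using w by (auto simp: adj_M cop.scale_minus_left)
  have "w - adj w = scale_op (- \<i> * b) r"
    using arg_cong[OF b, of "scale_op (- \<i>)"] by (simp add: cop.scale_right_diff_distrib)
  then have "(w + adj w) + (w - adj w) = scale_op (a - \<i> * b) r"
    using a by (simp add: cop.scale_left_diff_distrib)
  then have two: "w + w = scale_op (a - \<i> * b) r"
    by simp
  have "w = scale_op (1 / 2 + 1 / 2) w"
    by simp
  also have "\<dots> = scale_op (1 / 2) (w + w)"
    by (simp only: cop.scale_right_distrib cop.scale_left_distrib)
  also have "\<dots> = scale_op ((a - \<i> * b) / 2) r"
    unfolding two by simp
  finally show ?thesis
    by (intro that[of "(a - \<i> * b) / 2"]) (simp add: w_def)
qed

end

section \<open>Factorization in logmodular subalgebras\<close>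

locale logmodular_subalgebra = finite_dim_star_algebra M
  for M :: "('h::complex_hilbert_space \<Rightarrow>\<^sub>L 'h) set" +
  fixes A :: "('h \<Rightarrow>\<^sub>L 'h) set"
  assumes unital_A: "unital_subalgebra A"
    and subset: "A \<subseteq> M"
    and logmod: "logmodular M A"
begin

lemma A_mem: "a \<in> A \<Longrightarrow> a \<in> M"
  using subset by blast

lemma A_compose: "a \<in> A \<Longrightarrow> b \<in> A \<Longrightarrow> a \<cdot> b \<in> A"
  and subspace_A: "cop.subspace A"
  using unital_A unfolding unital_subalgebra_def by auto

lemma A_add: "a \<in> A \<Longrightarrow> b \<in> A \<Longrightarrow> a + b \<in> A"
  using subspace_A by (rule cop.subspace_add)

lemma finite_dim_A: "finite_dimensional A"
  using finite_dim subset by (rule finite_dimensional_subset)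

text \<open>The norms of the approximating factors are controlled by those of $a_n^*a_n$. The inverses
  $b_n$ have to be bounded as well, for only then is the limit of the $a_n$ invertible in \<open>A\<close>.\<close>

lemma positive_invertible_factorization:
  assumes "x \<in> positive_invertibles M"
  obtains a b where "a \<in> A" "b \<in> A" "a \<cdot> b = id_blinfun" "b \<cdot> a = id_blinfun" "adj a \<cdot> a = x"
proof -
  obtain y where y: "y \<cdot> x = id_blinfun" and xM: "x \<in> M"
    using assms unfolding positive_invertibles_def invertibles_def by auto
  have "x \<in> closure {adj a \<cdot> a | a. a \<in> invertibles A}"
    using assms logmod unfolding logmodular_def by blast
  then obtain f where f: "\<And>n. f n \<in> {adj a \<cdot> a | a. a \<in> invertibles A}" "f \<longlonglongrightarrow> x"
    unfolding closure_sequential by blast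
  have "\<forall>n. \<exists>a b. f n = adj a \<cdot> a \<and> a \<in> A \<and> b \<in> A \<and> a \<cdot> b = id_blinfun"
    using f(1) unfolding invertibles_def by blast
  then obtain a b where ab: "\<And>n. f n = adj (a n) \<cdot> a n" "\<And>n. a n \<in> A" "\<And>n. b n \<in> A"
      "\<And>n. a n \<cdot> b n = id_blinfun"
    by metis
  have aB: "a n \<in> bounded_operators" for n
    using ab A_mem bounded_of_mem by blast
  obtain K where K: "\<And>n. norm (f n) \<le> K"
    using convergent_imp_Bseq[of f] f(2) unfolding convergent_def Bseq_def by blast
  have na: "norm (a n) \<le> sqrt K" for n
    using norm_le_of_adj_compose_self[OF aB, of n] K[of n] ab(1)[of n]
    by (intro real_le_rsqrt) simp
  have "(\<lambda>n. y \<cdot> f n) \<longlonglongrightarrow> y \<cdot> x"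
    by (intro bounded_bilinear.tendsto[OF bounded_bilinear_blinfun_compose] tendsto_const f)
  then have "\<forall>\<^sub>F n in sequentially. dist (y \<cdot> f n) id_blinfun < 1 / 2"
    using y by (intro tendstoD) auto
  then obtain N where N: "\<And>n. N \<le> n \<Longrightarrow> norm (y \<cdot> f n - id_blinfun) < 1 / 2"
    by (auto simp: eventually_sequentially dist_norm)
  have nb: "norm (b (n + N)) \<le> 2 * (norm y * sqrt K)" for n
  proof -
    let ?n = "n + N"
    \<comment> \<open>Since \<open>y (a\<^sup>* a)\<close> is within \<open>1/2\<close> of \<open>1\<close>, the element \<open>b\<close> is controlled by \<open>y (a\<^sup>* a) b = y a\<^sup>*\<close>.\<close>
    have "b ?n = y \<cdot> adj (a ?n) - (y \<cdot> f ?n - id_blinfun) \<cdot> b ?n"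
      by (simp add: op_algebra ab(1,4))
    then have "norm (b ?n) \<le> norm (y \<cdot> adj (a ?n)) + norm ((y \<cdot> f ?n - id_blinfun) \<cdot> b ?n)"
      by (metis norm_triangle_ineq4)
    also have "\<dots> \<le> norm y * norm (adj (a ?n)) + norm (y \<cdot> f ?n - id_blinfun) * norm (b ?n)"
      by (intro add_mono norm_blinfun_compose)
    also have "\<dots> \<le> norm y * sqrt K + 1 / 2 * norm (b ?n)"
      using N[of ?n] norm_adj_le[OF aB] na
      by (intro add_mono mult_mono) (auto intro: order_trans less_imp_le)
    finally show ?thesis by simp
  qed
  obtain a' r where a': "a' \<in> A" "strict_mono r" "((\<lambda>n. a (n + N)) \<circ> r) \<longlonglongrightarrow> a'"
    using bounded_seq_convergent[OF subspace_A finite_dim_A, of "\<lambda>n. a (n + N)" "sqrt K"] ab na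
    by metis
  obtain b' s where b': "b' \<in> A" "strict_mono s" "((\<lambda>n. b (r n + N)) \<circ> s) \<longlonglongrightarrow> b'"
    using bounded_seq_convergent[OF subspace_A finite_dim_A, of "\<lambda>n. b (r n + N)"] ab nb
    by metis
  define t where "t n = r (s n) + N" for n
  have at: "(\<lambda>n. a (t n)) \<longlonglongrightarrow> a'"
    using LIMSEQ_subseq_LIMSEQ[OF a'(3) b'(2)] by (simp add: t_def o_def)
  have bt: "(\<lambda>n. b (t n)) \<longlonglongrightarrow> b'"
    using b'(3) by (simp add: t_def o_def)
  have "strict_mono t"
    unfolding t_def using strict_mono_o[OF a'(2) b'(2)] by (auto simp: strict_mono_def)
  then have ft: "(\<lambda>n. f (t n)) \<longlonglongrightarrow> x"
    using LIMSEQ_subseq_LIMSEQ[OF f(2)] by (simp add: o_def)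
  have "(\<lambda>n. a (t n) \<cdot> b (t n)) \<longlonglongrightarrow> a' \<cdot> b'"
    by (intro bounded_bilinear.tendsto[OF bounded_bilinear_blinfun_compose] at bt)
  then have ab': "a' \<cdot> b' = id_blinfun"
    by (simp add: ab LIMSEQ_const_iff)
  have "(\<lambda>n. adj (a (t n)) \<cdot> a (t n)) \<longlonglongrightarrow> adj a' \<cdot> a'"
    using a' aB A_mem bounded_of_mem
    by (intro bounded_bilinear.tendsto[OF bounded_bilinear_blinfun_compose] at tendsto_adj) auto
  then have x: "adj a' \<cdot> a' = x"
    using LIMSEQ_unique ft by (simp add: ab)
  have "y \<cdot> adj a' \<cdot> a' = id_blinfun"
    using x y by (simp add: compose_assoc)
  then have "y \<cdot> adj a' \<cdot> a' \<cdot> b' = b'"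
    by simp
  then have "y \<cdot> adj a' = b'"
    using ab' by (simp add: compose_assoc)
  then have "b' \<cdot> a' = id_blinfun"
    using \<open>y \<cdot> adj a' \<cdot> a' = id_blinfun\<close> by simp
  then show ?thesis
    using that a' b' ab' x by blast
qed

text \<open>Positivity makes left multiplication by $y^*y + \varepsilon$ injective on \<open>M\<close>, which by finite dimension
  yields the inverse.\<close>

lemma shifted_positive_invertible:
  assumes y: "y \<in> M" and \<epsilon>: "0 < \<epsilon>"
  shows "adj y \<cdot> y + \<epsilon> *\<^sub>R id_blinfun \<in> positive_invertibles M"
proof -
  define k where "k = adj y \<cdot> y + \<epsilon> *\<^sub>R id_blinfun"
  have kM: "k \<in> M"
    unfolding k_def using y by (simp add: mem_simps flip: scale_op_of_real)
  have adj_k: "adj k = k"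
    unfolding k_def using y by (simp add: mem_simps adj_M flip: scale_op_of_real)
  have form: "cinner (k v) v = complex_of_real ((norm (y v))\<^sup>2 + \<epsilon> * (norm v)\<^sup>2)" for v
  proof -
    have "cinner v v = complex_of_real ((norm v)\<^sup>2)"
      by (simp add: complex_eq_iff power2_norm_eq_cinner Im_cinner_self)
    then show ?thesis
      using adj_compose_self_apply[OF bounded_of_mem[OF y], of v]
      by (simp add: k_def blinfun.bilinear_simps cinner_add_left cinner_scaleR_left)
  qed
  have "x = 0" if "k \<cdot> x = 0" for x
  proof (rule blinfun_eqI)
    fix v
    have "k (x v) = 0"
      using that by (metis blinfun_apply_blinfun_compose zero_blinfun.rep_eq)
    then have "complex_of_real ((norm (y (x v)))\<^sup>2 + \<epsilon> * (norm (x v))\<^sup>2) = 0"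
      using form[of "x v"] cinner_scaleR_left[of 0 "x v" "x v"] by simp
    then have "(norm (y (x v)))\<^sup>2 + \<epsilon> * (norm (x v))\<^sup>2 = 0"
      using of_real_eq_0_iff by blast
    moreover have "0 \<le> (norm (y (x v)))\<^sup>2" "0 \<le> \<epsilon> * (norm (x v))\<^sup>2"
      using \<epsilon> by auto
    ultimately have "\<epsilon> * (norm (x v))\<^sup>2 = 0"
      by linarith
    then show "x v = blinfun_apply 0 v"
      using \<epsilon> by simp
  qed
  then obtain m where m: "m \<in> M" "k \<cdot> m = id_blinfun"
    using injective_left_mult_surj[OF subspace_M finite_dim bounded_of_mem[OF kM], of id_blinfun]
      kM by (auto simp: mem_simps)
  have "adj m \<cdot> k = id_blinfun"
    using arg_cong[OF m(2), of adj] m(1) kM adj_k by (simp add: adj_M)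
  then have "m \<cdot> k = id_blinfun"
    using m(2) by (metis compose_assoc compose_id)
  moreover have "positive_op k"
    unfolding positive_op_def using form \<epsilon> kM
    by (auto simp: bounded_of_mem complex_nonneg_Reals_iff)
  ultimately show ?thesis
    using kM m unfolding positive_invertibles_def invertibles_def k_def by blast
qed

lemma LatD:
  assumes "p \<in> Lat M A"
  shows "p \<in> projections M" "p \<in> M" "p \<cdot> p = p" "adj p = p"
    and "a \<in> A \<Longrightarrow> p \<cdot> (a \<cdot> p) = a \<cdot> p"
  using assms unfolding Lat_def projections_def by (auto simp: compose_assoc)

lemma LatI:
  assumes "p \<in> projections M" "\<And>a. a \<in> A \<Longrightarrow> p \<cdot> (a \<cdot> p) = a \<cdot> p"
  shows "p \<in> Lat M A"
  using assms unfolding Lat_def by (auto simp: compose_assoc)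

text \<open>Uniqueness of triangular factorization: $p a^* = p a^* p$ turns $p a^*a (1-p) = 0$ into
  $p a^* \cdot p a (1-p) = 0$, and $p a^*$ can be cancelled by means of the equally triangular inverse
  \<open>b\<close> of \<open>a\<close>.\<close>

lemma commute_of_commute_square:
  assumes p: "p \<in> Lat M A"
    and ab: "a \<in> A" "b \<in> A" "a \<cdot> b = id_blinfun"
    and comm: "p \<cdot> (adj a \<cdot> a) = adj a \<cdot> a \<cdot> p"
  shows "p \<cdot> a = a \<cdot> p"
proof -
  note pD = LatD[OF p]
  have M: "a \<in> M" "b \<in> M"
    using ab A_mem by auto
  have pa: "p \<cdot> (adj a \<cdot> p) = p \<cdot> adj a"
    using arg_cong[OF pD(5)[OF ab(1)], of adj] M pD by (simp add: adj_M mem_simps compose_assoc)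
  have pb: "p \<cdot> (adj b \<cdot> p) = p \<cdot> adj b"
    using arg_cong[OF pD(5)[OF ab(2)], of adj] M pD by (simp add: adj_M mem_simps compose_assoc)
  have ba: "adj b \<cdot> adj a = id_blinfun"
    using arg_cong[OF ab(3), of adj] M by (simp add: adj_M)
  have "p \<cdot> (adj a \<cdot> (p \<cdot> (a - a \<cdot> p))) = p \<cdot> (adj a \<cdot> p) \<cdot> (a - a \<cdot> p)"
    by (simp add: compose_assoc)
  also have "\<dots> = p \<cdot> (adj a \<cdot> a) - p \<cdot> (adj a \<cdot> a) \<cdot> p"
    unfolding pa by (simp add: compose_assoc compose_diff_right)
  also have "\<dots> = 0"
    unfolding comm by (simp add: compose_assoc pD)
  finally have z: "p \<cdot> (adj a \<cdot> (p \<cdot> (a - a \<cdot> p))) = 0" .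
  have "p \<cdot> (a - a \<cdot> p) = p \<cdot> (adj b \<cdot> adj a) \<cdot> (p \<cdot> (a - a \<cdot> p))"
    unfolding ba by (simp add: compose_assoc compose_eq_cong[OF pD(3)])
  also have "\<dots> = p \<cdot> (adj b \<cdot> p) \<cdot> (adj a \<cdot> (p \<cdot> (a - a \<cdot> p)))"
    unfolding pb by (simp add: compose_assoc)
  also have "\<dots> = 0"
    using z by (simp add: compose_assoc)
  finally show ?thesis
    using pD(5)[OF ab(1)] by (simp add: compose_diff_right)
qed

text \<open>The factor is the limit of factors of $y^*y + 1/n$. The commutation property is established for
  those, as it needs invertibility, and it survives the limit.\<close>

lemma factorization:
  assumes y: "y \<in> M"
  obtains a where "a \<in> A" "adj a \<cdot> a = adj y \<cdot> y"
    "\<And>p. p \<in> Lat M A \<Longrightarrow> p \<cdot> (adj y \<cdot> y) = adj y \<cdot> y \<cdot> p \<Longrightarrow> p \<cdot> a = a \<cdot> p"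
proof -
  define f where "f n = adj y \<cdot> y + (1 / real (Suc n)) *\<^sub>R id_blinfun" for n
  have "\<forall>n. \<exists>a b. a \<in> A \<and> b \<in> A \<and> a \<cdot> b = id_blinfun \<and> adj a \<cdot> a = f n"
    unfolding f_def by (metis positive_invertible_factorization shifted_positive_invertible[OF y]
        zero_less_divide_1_iff of_nat_0_less_iff zero_less_Suc)
  then obtain a b where ab: "\<And>n. a n \<in> A" "\<And>n. b n \<in> A" "\<And>n. a n \<cdot> b n = id_blinfun"
      "\<And>n. adj (a n) \<cdot> a n = f n"
    by metis
  have aB: "a n \<in> bounded_operators" for n
    using ab A_mem bounded_of_mem by blast
  have "(\<lambda>n. 1 / real (Suc n)) \<longlonglongrightarrow> 0"
    by (intro LIMSEQ_Suc lim_1_over_n)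
  then have "f \<longlonglongrightarrow> adj y \<cdot> y + 0 *\<^sub>R id_blinfun"
    unfolding f_def by (intro tendsto_intros)
  then have f: "f \<longlonglongrightarrow> adj y \<cdot> y"
    by simp
  then obtain K where K: "\<And>n. norm (f n) \<le> K"
    using convergent_imp_Bseq[of f] unfolding convergent_def Bseq_def by blast
  have na: "norm (a n) \<le> sqrt K" for n
    using norm_le_of_adj_compose_self[OF aB, of n] K[of n] ab(4)[of n]
    by (intro real_le_rsqrt) simp
  obtain a' r where a': "a' \<in> A" "strict_mono r" "(a \<circ> r) \<longlonglongrightarrow> a'"
    using bounded_seq_convergent[OF subspace_A finite_dim_A, of a "sqrt K"] ab na by metis
  have ar: "(\<lambda>n. a (r n)) \<longlonglongrightarrow> a'"
    using a' by (simp add: o_def)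
  have "(\<lambda>n. adj (a (r n)) \<cdot> a (r n)) \<longlonglongrightarrow> adj a' \<cdot> a'"
    using a' aB A_mem bounded_of_mem
    by (intro bounded_bilinear.tendsto[OF bounded_bilinear_blinfun_compose] ar tendsto_adj) auto
  moreover have "(\<lambda>n. f (r n)) \<longlonglongrightarrow> adj y \<cdot> y"
    using LIMSEQ_subseq_LIMSEQ[OF f a'(2)] by (simp add: o_def)
  ultimately have sq: "adj a' \<cdot> a' = adj y \<cdot> y"
    using LIMSEQ_unique by (simp add: ab)
  have "p \<cdot> a' = a' \<cdot> p" if p: "p \<in> Lat M A" "p \<cdot> (adj y \<cdot> y) = adj y \<cdot> y \<cdot> p" for p
  proof -
    have "p \<cdot> f n = f n \<cdot> p" for n
      using p LatD[OF p(1)] unfolding f_def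
      by (simp add: compose_add_left compose_add_right scale_op_compose_left
          scale_op_compose_right bounded_of_mem flip: scale_op_of_real)
    then have comm: "p \<cdot> a n = a n \<cdot> p" for n
      using commute_of_commute_square[OF p(1) ab(1) ab(2) ab(3), of n] ab(4) by simp
    have "(\<lambda>n. p \<cdot> a (r n)) \<longlonglongrightarrow> p \<cdot> a'"
      by (intro bounded_bilinear.tendsto[OF bounded_bilinear_blinfun_compose] ar tendsto_const)
    moreover have "(\<lambda>n. a (r n) \<cdot> p) \<longlonglongrightarrow> a' \<cdot> p"
      by (intro bounded_bilinear.tendsto[OF bounded_bilinear_blinfun_compose] ar tendsto_const)
    ultimately show ?thesis
      using LIMSEQ_unique by (simp add: comm)
  qed
  then show ?thesis
    using that a' sq by blast
qed

lemma projection_factorization: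
  assumes "r \<in> projections M"
  obtains a where "a \<in> A" "adj a \<cdot> a = r" "a \<cdot> r = a"
    "\<And>p. p \<in> Lat M A \<Longrightarrow> p \<cdot> r = r \<cdot> p \<Longrightarrow> p \<cdot> a = a \<cdot> p"
proof -
  note rD = projectionD[OF assms]
  have rr: "adj r \<cdot> r = r"
    by (simp add: rD)
  obtain a where a: "a \<in> A" "adj a \<cdot> a = r" "\<And>p. p \<in> Lat M A \<Longrightarrow> p \<cdot> r = r \<cdot> p \<Longrightarrow> p \<cdot> a = a \<cdot> p"
    by (rule factorization[OF rD(1), unfolded rr]) (rule that)
  have "a \<cdot> (id_blinfun - r) = 0"
    by (rule adj_compose_self_cancel[OF A_mem[OF a(1)]]) (simp add: a(2) compose_diff_right rD(2))
  then have "a \<cdot> r = a"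
    by (simp add: compose_diff_right)
  then show ?thesis
    by (rule that[OF a(1,2) _ a(3)])
qed

section \<open>The invariant projections\<close>

text \<open>A factor \<open>a\<close> of $p = a^*a$ commuting with \<open>p\<close> acts injectively on the left of \<open>p A\<close>, so \<open>a \<cdot> b = a\<close> for
  some \<open>b\<close> in \<open>p A\<close>; multiplying by $a^*$ identifies \<open>b\<close> as \<open>p\<close>.\<close>

lemma Lat_subset: "Lat M A \<subseteq> A"
proof
  fix p assume p: "p \<in> Lat M A"
  note pD = LatD[OF p]
  obtain a where a: "a \<in> A" "adj a \<cdot> a = p" "a \<cdot> p = a" "p \<cdot> a = a \<cdot> p"
    using projection_factorization[OF pD(1)] p by metis
  define V where "V = {b \<in> A. p \<cdot> b = b}"
  have V: "cop.subspace V" "finite_dimensional V"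
    unfolding V_def using subspace_A finite_dim_A pD
    by (auto intro!: cop.subspaceI elim!: finite_dimensional_subset
        simp: cop.subspace_0 cop.subspace_add cop.subspace_scale compose_add_right
          scale_op_compose_right bounded_of_mem)
  have "\<exists>b\<in>V. a \<cdot> b = a"
  proof (rule injective_left_mult_surj[OF V])
    show "a \<in> bounded_operators"
      using a A_mem bounded_of_mem by blast
    show "a \<cdot> x \<in> V" if "x \<in> V" for x
      using that a A_compose unfolding V_def by (simp flip: compose_assoc)
    show "x = 0" if "x \<in> V" "a \<cdot> x = 0" for x
    proof -
      have "x = adj a \<cdot> a \<cdot> x"
        using that a unfolding V_def by simp
      also have "\<dots> = 0"
        using that by (simp add: compose_assoc)
      finally show ?thesis .
    qed
    show "a \<in> V"
      using a unfolding V_def by simp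
  qed
  then obtain b where b: "b \<in> A" "p \<cdot> b = b" "a \<cdot> b = a"
    unfolding V_def by blast
  have "p = adj a \<cdot> (a \<cdot> b)"
    using b(3) a(2) by simp
  also have "\<dots> = p \<cdot> b"
    by (simp add: a(2) flip: compose_assoc)
  finally show "p \<in> A"
    using b by simp
qed

lemma Lat_commute:
  assumes "p \<in> Lat M A" "q \<in> Lat M A"
  shows "p \<cdot> q = q \<cdot> p"
proof -
  have "q \<in> A"
    using assms Lat_subset by blast
  then have eq: "p \<cdot> (q \<cdot> p) = q \<cdot> p"
    using LatD(5)[OF assms(1)] by blast
  have "p \<cdot> (q \<cdot> p) = p \<cdot> q"
    using arg_cong[OF eq, of adj] LatD(2,4)[OF assms(1)] LatD(2,4)[OF assms(2)]
    by (simp add: adj_M mem_simps compose_assoc)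
  then show ?thesis
    using eq by simp
qed

lemma Lat_meet:
  assumes p: "p \<in> Lat M A" and q: "q \<in> Lat M A"
  shows "p \<cdot> q \<in> Lat M A"
proof (rule LatI)
  note pD = LatD[OF p] and qD = LatD[OF q] and c = Lat_commute[OF p q]
  show "p \<cdot> q \<in> projections M"
  proof (rule projectionI)
    show "p \<cdot> q \<cdot> (p \<cdot> q) = p \<cdot> q"
      by (metis c compose_assoc pD(3) qD(3))
  qed (use pD qD c in \<open>simp_all add: mem_simps adj_M\<close>)
  fix a assume a: "a \<in> A"
  have "p \<cdot> (a \<cdot> (p \<cdot> q)) = a \<cdot> (p \<cdot> q)"
    using pD(5)[OF a] by (metis compose_assoc)
  moreover have "q \<cdot> (a \<cdot> (p \<cdot> q)) = a \<cdot> (p \<cdot> q)"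
    unfolding c using qD(5)[OF a] by (metis compose_assoc)
  ultimately show "p \<cdot> q \<cdot> (a \<cdot> (p \<cdot> q)) = a \<cdot> (p \<cdot> q)"
    by (simp add: compose_assoc)
qed

lemma Lat_join:
  assumes p: "p \<in> Lat M A" and q: "q \<in> Lat M A"
  shows "p + q - p \<cdot> q \<in> Lat M A"
proof (rule LatI)
  note pD = LatD[OF p] and qD = LatD[OF q] and c = Lat_commute[OF p q]
  note mD = LatD[OF Lat_meet[OF p q]]
  have pm: "p \<cdot> (p \<cdot> q) = p \<cdot> q" and mp: "p \<cdot> (q \<cdot> p) = p \<cdot> q"
    and qm: "q \<cdot> (p \<cdot> q) = p \<cdot> q" and qp: "q \<cdot> p = p \<cdot> q"
    and pq: "q \<cdot> (p \<cdot> x) = p \<cdot> (q \<cdot> x)" for x :: "'h \<Rightarrow>\<^sub>L 'h"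
    using pD(3) qD(3) c by (metis compose_assoc)+
  show "p + q - p \<cdot> q \<in> projections M"
    by (rule projectionI)
      (use pD qD c in \<open>simp_all add: mem_simps adj_M op_algebra pm qp pq\<close>)
  fix a assume a: "a \<in> A"
  have pa: "p \<cdot> (a \<cdot> (p \<cdot> x)) = a \<cdot> (p \<cdot> x)" and qa: "q \<cdot> (a \<cdot> (q \<cdot> x)) = a \<cdot> (q \<cdot> x)"
    for x :: "'h \<Rightarrow>\<^sub>L 'h"
    using compose_eq_cong[OF pD(5)[OF a], of x] compose_eq_cong[OF qD(5)[OF a], of x]
    by (simp_all add: compose_assoc)
  show "(p + q - p \<cdot> q) \<cdot> (a \<cdot> (p + q - p \<cdot> q)) = a \<cdot> (p + q - p \<cdot> q)"
    by (simp add: op_algebra pa qa pD(5)[OF a] qD(5)[OF a] flip: pq)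
qed

section \<open>Covers in the lattice of invariant projections\<close>

text \<open>On the range of \<open>f = t + d\<close>, a difference of two invariant projections, the compression of \<open>A\<close> is
  block diagonal. Every $y^*y$ living on \<open>f\<close> is $a^*a$ with \<open>a\<close> commuting with \<open>f\<close>, hence itself block
  diagonal; taking \<open>y = t + t \<cdot> (m \<cdot> d)\<close>, the corner of $y^*y$ is exactly \<open>t \<cdot> (m \<cdot> d)\<close>.\<close>

lemma off_diagonal_vanishes:
  assumes e: "e \<in> Lat M A" and q: "q \<in> Lat M A"
    and td: "t \<in> projections M" "d \<in> projections M" "t + d = q - e" "t \<cdot> d = 0" "q \<cdot> e = e"
    and zero: "\<And>a. a \<in> A \<Longrightarrow> t \<cdot> (a \<cdot> d) = 0" "\<And>a. a \<in> A \<Longrightarrow> d \<cdot> (a \<cdot> t) = 0"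
    and m: "m \<in> M"
  shows "t \<cdot> (m \<cdot> d) = 0"
proof -
  note eD = LatD(1-4)[OF e] and qD = LatD(1-4)[OF q] and tD = projectionD[OF td(1)] and dD = projectionD[OF td(2)]
  define f where "f = t + d"
  have dt: "d \<cdot> t = 0"
    using arg_cong[OF td(4), of adj] tD dD by (simp add: adj_M)
  have f: "f \<in> M" "adj f = f" "f \<cdot> t = t" "f \<cdot> d = d" "t \<cdot> f = t" "d \<cdot> f = d"
    unfolding f_def using tD dD dt td(4) by (simp_all add: mem_simps adj_M op_algebra)
  have eq: "e \<cdot> q = e"
    using projection_le_commute[OF eD(1) qD(1) td(5)] .
  have qf: "q \<cdot> f = f" "f \<cdot> q = f" "e \<cdot> f = 0" "f \<cdot> e = 0"
    unfolding f_def td(3) using eD qD td(5) eq by (simp_all add: op_algebra)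
  define w where "w = t \<cdot> (m \<cdot> d)"
  define y where "y = t + w"
  have wM: "w \<in> M"
    unfolding w_def using tD dD m by (simp add: mem_simps)
  have w: "t \<cdot> w = w" "w \<cdot> d = w" "w \<cdot> t = 0" "d \<cdot> w = 0"
    unfolding w_def using compose_eq_cong[OF tD(2)] compose_eq_cong[OF dt] dD dt by (simp_all add: compose_assoc)
  have yM: "y \<in> M"
    unfolding y_def using wM tD by (simp add: mem_simps)
  have yf: "y \<cdot> f = y"
    unfolding y_def f_def using w tD dD td(4) by (simp add: op_algebra)
  have fy: "f \<cdot> adj y = adj y"
  proof -
    have "f \<cdot> adj y = adj (y \<cdot> f)"
      using yM f by (simp add: adj_M)
    then show ?thesis unfolding yf .
  qed
  define h where "h = adj y \<cdot> y"
  have hf: "h \<cdot> f = h" "f \<cdot> h = h"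
    unfolding h_def using yf fy by (simp_all add: compose_assoc compose_eq_cong[OF fy])
  have hq: "q \<cdot> h = h \<cdot> q"
    using compose_eq_cong[OF qf(1), of h] compose_eq_cong[OF hf(1), of q] qf hf by simp
  have he: "e \<cdot> h = h \<cdot> e"
    using compose_eq_cong[OF qf(3), of h] compose_eq_cong[OF hf(1), of e] qf hf by simp
  obtain a where a: "a \<in> A" "adj a \<cdot> a = h" "q \<cdot> a = a \<cdot> q" "e \<cdot> a = a \<cdot> e"
    using factorization[OF yM, folded h_def] hq he q e by metis
  have aM: "a \<in> M" using a A_mem by blast
  have fa: "f \<cdot> a = a \<cdot> f"
    unfolding f_def td(3) using a by (simp add: op_algebra)
  have ad: "a \<cdot> d = d \<cdot> (a \<cdot> d)"
  proof -
    have "a \<cdot> d = a \<cdot> f \<cdot> d" using f by (simp add: compose_assoc)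
    also have "\<dots> = f \<cdot> (a \<cdot> d)" by (simp add: fa flip: compose_assoc)
    also have "\<dots> = d \<cdot> (a \<cdot> d)" unfolding f_def using zero(1)[OF a(1)] by (simp add: op_algebra)
    finally show ?thesis .
  qed
  have at: "a \<cdot> t = t \<cdot> (a \<cdot> t)"
  proof -
    have "a \<cdot> t = a \<cdot> f \<cdot> t" using f by (simp add: compose_assoc)
    also have "\<dots> = f \<cdot> (a \<cdot> t)" by (simp add: fa flip: compose_assoc)
    also have "\<dots> = t \<cdot> (a \<cdot> t)" unfolding f_def using zero(2)[OF a(1)] by (simp add: op_algebra)
    finally show ?thesis .
  qed
  have "t \<cdot> adj a = t \<cdot> adj a \<cdot> t"
  proof -
    have "t \<cdot> adj a = adj (a \<cdot> t)"
      using aM tD by (simp add: adj_M)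
    also have "\<dots> = adj (t \<cdot> (a \<cdot> t))"
      using at by simp
    finally show ?thesis
      using aM tD by (simp add: adj_M mem_simps compose_assoc)
  qed
  then have "t \<cdot> adj a \<cdot> (a \<cdot> d) = t \<cdot> adj a \<cdot> t \<cdot> (d \<cdot> (a \<cdot> d))"
    using ad by simp
  then have "t \<cdot> (h \<cdot> d) = 0"
    using a(2) by (simp add: compose_assoc compose_eq_cong[OF td(4)] flip: a(2))
  moreover have "t \<cdot> (h \<cdot> d) = w"
  proof -
    have "y \<cdot> d = w"
      unfolding y_def using w td(4) by (simp add: op_algebra)
    moreover have "t \<cdot> adj y = t"
    proof -
      have "t \<cdot> adj y = adj (y \<cdot> t)"
        using yM tD by (simp add: adj_M)
      also have "y \<cdot> t = t"
        unfolding y_def using w tD by (simp add: op_algebra)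
      finally show ?thesis using tD by simp
    qed
    ultimately show ?thesis
      unfolding h_def using w by (simp add: compose_assoc compose_eq_cong)
  qed
  ultimately show ?thesis
    by (simp add: w_def)
qed

definition covers :: "('h \<Rightarrow>\<^sub>L 'h) \<Rightarrow> ('h \<Rightarrow>\<^sub>L 'h) \<Rightarrow> bool"
  where "covers q p \<longleftrightarrow> p \<in> Lat M A \<and> q \<in> Lat M A \<and> q \<cdot> p = p \<and> q \<noteq> p \<and>
    (\<forall>u\<in>Lat M A. u \<cdot> p = p \<longrightarrow> q \<cdot> u = u \<longrightarrow> u = p \<or> u = q)"

text \<open>In the proof \<open>J = Y M = s M\<close> for \<open>Y = A \<inter> q M r\<close>. That \<open>A J \<subseteq> J\<close> makes \<open>s\<close> invariant, and that
  \<open>J r \<subseteq> A\<close> is where minimality of \<open>r\<close> is used.\<close>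

lemma cover_minimal_column:
  assumes cov: "covers q p" and r: "minimal_projection r" "(q - p) \<cdot> r = r" and m: "m \<in> M"
  shows "q \<cdot> m \<cdot> r \<in> A"
proof -
  have p: "p \<in> Lat M A" and q: "q \<in> Lat M A" and qp: "q \<cdot> p = p"
    using cov unfolding covers_def by auto
  note pD = LatD[OF p] and qD = LatD[OF q]
  have pq: "p \<cdot> q = p"
    using projection_le_commute[OF pD(1) qD(1) qp] .
  define d where "d = q - p"
  have d: "d \<in> projections M"
    unfolding d_def using pD qD qp by (intro projection_diff)
  have pd: "p \<cdot> d = 0" "d \<cdot> p = 0" "q \<cdot> d = d" "d \<cdot> q = d"
    unfolding d_def using pD(3) qD(3) qp pq by (simp_all add: op_algebra)
  have rP: "r \<in> projections M" and r0: "r \<noteq> 0"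
    using r(1) unfolding minimal_projection_def by auto
  note rD = projectionD[OF rP]
  have dr: "d \<cdot> r = r"
    using r(2) by (simp add: d_def)
  have rd: "r \<cdot> d = r"
    using projection_le_commute[OF rP d dr] .
  have pr: "p \<cdot> r = 0" "q \<cdot> r = r"
    using compose_eq_cong[OF pd(1), of r] compose_eq_cong[OF pd(3), of r] dr by simp_all
  have rp: "r \<cdot> p = 0" "r \<cdot> q = r"
    using compose_eq_cong[OF rd, of p] compose_eq_cong[OF rd, of q] pd rd by simp_all
  obtain a where a: "a \<in> A" "adj a \<cdot> a = r" "a \<cdot> r = a" "p \<cdot> a = a \<cdot> p" "q \<cdot> a = a \<cdot> q"
    using projection_factorization[OF rP] p q pr rp by metis
  have qa: "q \<cdot> a = a" and pa: "p \<cdot> a = 0"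
    using a(3-5) rp by (metis compose_assoc compose_zero(2))+
  have a0: "a \<noteq> 0"
    using a(2) r0 by auto
  define Y where "Y = {x \<in> A. q \<cdot> x = x \<and> x \<cdot> r = x}"
  define J where "J = cop.span {x \<cdot> m | x m. x \<in> Y \<and> m \<in> M}"
  have sub_J: "cop.subspace J"
    unfolding J_def by (rule cop.subspace_span)
  have gen: "x \<cdot> m \<in> J" if "x \<in> Y" "m \<in> M" for x m
    unfolding J_def using that by (intro cop.span_base) blast
  have J_le: "J \<subseteq> W" if "cop.subspace W" "\<And>x m. x \<in> Y \<Longrightarrow> m \<in> M \<Longrightarrow> x \<cdot> m \<in> W" for W
    unfolding J_def using that by (intro cop.span_minimal) auto
  have YM: "x \<in> M" if "x \<in> Y" for x
    using that A_mem unfolding Y_def by auto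
  have J_M: "J \<subseteq> M"
    using YM by (intro J_le subspace_M compose_mem)
  have J_right: "z \<cdot> n \<in> J" if "z \<in> J" "n \<in> M" for z n
  proof -
    have "J \<subseteq> {z. z \<cdot> n \<in> J}"
      using that gen by (intro J_le subspace_right_mult_vimage sub_J) (simp add: compose_assoc compose_mem)
    then show ?thesis using that by blast
  qed
  have J_left: "b \<cdot> z \<in> J" if "z \<in> J" "b \<in> A" for z b
  proof -
    have "b \<cdot> x \<in> Y" if "x \<in> Y" for x
    proof -
      have x: "x \<in> A" "q \<cdot> x = x" "x \<cdot> r = x"
        using that unfolding Y_def by auto
      have "q \<cdot> (b \<cdot> (q \<cdot> x)) = b \<cdot> (q \<cdot> x)"
        using compose_eq_cong[OF qD(5)[OF \<open>b \<in> A\<close>], of x] by (simp add: compose_assoc)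
      then show ?thesis
        unfolding Y_def using x \<open>b \<in> A\<close> A_compose by (simp add: compose_assoc)
    qed
    then have "J \<subseteq> {z. b \<cdot> z \<in> J}"
      using that gen A_mem
      by (intro J_le subspace_left_mult_vimage sub_J bounded_of_mem) (auto simp flip: compose_assoc)
    then show ?thesis using that by blast
  qed
  have J_q: "q \<cdot> z = z" if "z \<in> J" for z
  proof -
    have "J \<subseteq> {z \<in> M. q \<cdot> z = z}"
      using YM by (intro J_le subspace_fixed qD)
        (auto simp: compose_mem compose_eq_cong Y_def simp flip: compose_assoc)
    then show ?thesis using that by blast
  qed
  have J_r: "z \<cdot> n \<cdot> r \<in> A" if "z \<in> J" "n \<in> M" for z n
  proof -
    have "x \<cdot> m' \<cdot> (n \<cdot> r) \<in> A" if x: "x \<in> Y" "m' \<in> M" for x m'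
    proof -
      obtain c where c: "r \<cdot> (m' \<cdot> n) \<cdot> r = scale_op c r"
        using minimal_projection_corner[OF r(1)] compose_mem x \<open>n \<in> M\<close> by metis
      have "x \<cdot> m' \<cdot> (n \<cdot> r) = x \<cdot> (r \<cdot> (m' \<cdot> n) \<cdot> r)"
        using x compose_eq_cong[of x r x] unfolding Y_def by (simp add: compose_assoc)
      also have "\<dots> = scale_op c x"
        unfolding c using x YM by (simp add: scale_op_compose_right bounded_of_mem Y_def)
      finally show ?thesis
        using x subspace_A by (simp add: Y_def cop.subspace_scale)
    qed
    then have "J \<subseteq> {z. z \<cdot> (n \<cdot> r) \<in> A}"
      by (intro J_le subspace_right_mult_vimage subspace_A) auto
    then show ?thesis using that by (auto simp: compose_assoc)
  qed
  obtain s where s: "s \<in> projections M" "s \<in> J" "\<And>z. z \<in> J \<Longrightarrow> s \<cdot> z = z"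
    using right_ideal_projection[OF J_M sub_J J_right] by metis
  have sL: "s \<in> Lat M A"
    using s J_left by (intro LatI) auto
  note sD = LatD[OF sL]
  have qs: "q \<cdot> s = s"
    using J_q s by blast
  have sq: "s \<cdot> q = s"
    using projection_le_commute[OF sD(1) qD(1) qs] .
  have sp: "s \<cdot> p = p \<cdot> s"
    using Lat_commute[OF sL p] .
  have sa: "s \<cdot> a = a"
  proof -
    have "a \<in> Y"
      unfolding Y_def using a qa by simp
    then show ?thesis
      using s(3)[OF gen[of a id_blinfun]] id_mem by simp
  qed
  \<comment> \<open>The join \<open>u\<close> of \<open>p\<close> and \<open>s\<close> is not \<open>p\<close>, because \<open>s \<cdot> a = a\<close> whereas \<open>p \<cdot> a = 0\<close>.\<close>
  define u where "u = p + s - p \<cdot> s"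
  have "u \<in> Lat M A"
    unfolding u_def using Lat_join[OF p sL] .
  moreover have "u \<cdot> p = p" "q \<cdot> u = u"
    unfolding u_def using pD(3) qp qs sp by (simp_all add: op_algebra compose_eq_cong[OF pD(3)] compose_eq_cong[OF qp])
  ultimately have "u = p \<or> u = q"
    using cov unfolding covers_def by blast
  moreover have "u \<noteq> p"
  proof
    assume "u = p"
    then have "s = p \<cdot> s" unfolding u_def by simp
    then have "a = p \<cdot> (s \<cdot> a)"
      using sa by (metis compose_assoc)
    then show False
      using sa pa a0 by simp
  qed
  ultimately have uq: "p + s - p \<cdot> s = q"
    unfolding u_def by simp
  define t where "t = q - s"
  have t: "t \<in> projections M"
    unfolding t_def using sD qD qs by (intro projection_diff)
  have d_eq: "d = s - p \<cdot> s" and t_eq: "t = p - p \<cdot> s"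
    unfolding d_def t_def uq[symmetric] by simp_all
  have pps: "p \<cdot> (p \<cdot> s) = p \<cdot> s" and sps: "s \<cdot> (p \<cdot> s) = p \<cdot> s"
    using pD(3) sD(3) sp by (metis compose_assoc)+
  have sd: "s \<cdot> d = d" and ts: "t \<cdot> s = 0" and pt: "p \<cdot> t = t"
    unfolding d_eq t_eq using pD(3) sD(3) sp pps sps by (simp_all add: op_algebra)
  \<comment> \<open>Both corners of \<open>A\<close> vanish: \<open>d\<close> lies below the invariant \<open>s\<close>, which is orthogonal to \<open>t\<close>, and \<open>t\<close> lies
    below the invariant \<open>p\<close>, which is orthogonal to \<open>d\<close>.\<close>
  have "t \<cdot> (m \<cdot> d) = 0"
  proof (rule off_diagonal_vanishes[OF Lat_meet[OF p sL] q t d _ _ _ _ _ m])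
    show "t + d = q - p \<cdot> s"
      by (simp add: t_def d_eq)
    show "t \<cdot> d = 0"
      using compose_eq_cong[OF ts, of d] sd by simp
    show "q \<cdot> (p \<cdot> s) = p \<cdot> s"
      using qp by (rule compose_eq_cong)
    fix b assume b: "b \<in> A"
    have "t \<cdot> (b \<cdot> d) = t \<cdot> (b \<cdot> s \<cdot> d)"
      using sd by (simp add: compose_assoc)
    also have "\<dots> = t \<cdot> (s \<cdot> (b \<cdot> s)) \<cdot> d"
      by (simp only: sD(5)[OF b] compose_assoc)
    also have "\<dots> = 0"
      by (simp add: ts flip: compose_assoc)
    finally show "t \<cdot> (b \<cdot> d) = 0" .
    have "d \<cdot> (b \<cdot> t) = d \<cdot> (b \<cdot> p \<cdot> t)"
      using pt by (simp add: compose_assoc)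
    also have "\<dots> = d \<cdot> (p \<cdot> (b \<cdot> p)) \<cdot> t"
      by (simp only: pD(5)[OF b] compose_assoc)
    also have "\<dots> = 0"
      by (simp add: pd(2) flip: compose_assoc)
    finally show "d \<cdot> (b \<cdot> t) = 0" .
  qed
  then have "t \<cdot> (m \<cdot> (d \<cdot> r)) = 0"
    by (metis compose_assoc compose_zero(1))
  then have "q \<cdot> m \<cdot> r = s \<cdot> m \<cdot> r"
    unfolding dr t_def by (simp add: op_algebra)
  then show ?thesis
    using J_r[OF s(2) m] by simp
qed

text \<open>Induction on the size of \<open>e\<close>, splitting off one minimal projection at a time.\<close>

lemma cover_columns:
  assumes cov: "covers q p" and m: "m \<in> M"
  shows "q \<cdot> m \<cdot> (q - p) \<in> A"
proof -
  have p: "p \<in> Lat M A" and q: "q \<in> Lat M A" and qp: "q \<cdot> p = p"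
    using cov unfolding covers_def by auto
  have "q \<cdot> m \<cdot> e \<in> A" if "e \<in> projections M" "(q - p) \<cdot> e = e" for e
    using that
  proof (induction "range_dim e" arbitrary: e rule: less_induct)
    case less
    show ?case
    proof (cases "e = 0")
      case True
      then show ?thesis
        using subspace_A by (simp add: cop.subspace_0)
    next
      case False
      obtain r where r: "minimal_projection r" "e \<cdot> r = r"
        using minimal_projection_below[OF less.prems(1) False] by metis
      then have rP: "r \<in> projections M" and "r \<noteq> 0"
        unfolding minimal_projection_def by auto
      have re: "r \<cdot> e = r"
        using projection_le_commute[OF rP less.prems(1) r(2)] .
      note eD = projectionD[OF less.prems(1)] and rD = projectionD[OF rP]
      have er: "e - r \<in> projections M"
        using projection_diff[OF rP less.prems(1) r(2)] .
      have le: "e \<cdot> (e - r) = e - r"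
        using eD r(2) by (simp add: op_algebra)
      have dr: "(q - p) \<cdot> r = r" and der: "(q - p) \<cdot> (e - r) = e - r"
        using compose_eq_cong[OF less.prems(2), of r] compose_eq_cong[OF less.prems(2), of "e - r"] r le
        by simp_all
      have "range_dim (e - r) < range_dim e"
        using \<open>r \<noteq> 0\<close> by (intro range_dim_less er less.prems le) auto
      then have "q \<cdot> m \<cdot> (e - r) \<in> A"
        using less.hyps er der by blast
      moreover have "q \<cdot> m \<cdot> r \<in> A"
        using cover_minimal_column[OF cov r(1) dr m] .
      ultimately have "q \<cdot> m \<cdot> (e - r) + q \<cdot> m \<cdot> r \<in> A"
        by (rule A_add)
      then show ?thesis
        by (simp flip: compose_add_right)
    qed
  qed
  moreover have "q - p \<in> projections M"
    using projection_diff LatD(1) p q qp by blast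
  ultimately show ?thesis
    using projectionD(2) by blast
qed

section \<open>Maximal chains of invariant projections\<close>

lemma op_le_of_compose:
  assumes "p \<in> projections M" "q \<in> projections M" "q \<cdot> p = p"
  shows "op_le p q"
proof -
  note D = projectionD[OF projection_diff[OF assms]]
  show ?thesis
    unfolding op_le_def positive_op_def
    using adj_compose_self_apply[OF bounded_of_mem[OF D(1)]] D
    by (simp add: bounded_of_mem complex_nonneg_Reals_iff)
qed

lemma cover_above:
  assumes p: "p \<in> Lat M A" and "p \<noteq> id_blinfun"
  obtains q where "covers q p"
proof -
  let ?P = "\<lambda>q. q \<in> Lat M A \<and> q \<cdot> p = p \<and> q \<noteq> p"
  have "?P id_blinfun"
    using assms id_projection by (auto intro!: LatI)
  then have "\<exists>q. ?P q \<and> (\<forall>u. ?P u \<longrightarrow> range_dim q \<le> range_dim u)"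
    by (rule ex_has_least_nat)
  then obtain q where q: "?P q" "\<And>u. ?P u \<Longrightarrow> range_dim q \<le> range_dim u"
    by auto
  have "u = p \<or> u = q" if "u \<in> Lat M A" "u \<cdot> p = p" "q \<cdot> u = u" for u
    using that q(2)[of u] q(1) range_dim_less[of u q] LatD(1) by fastforce
  then show ?thesis
    using that q p unfolding covers_def by auto
qed

text \<open>The nest is built upwards by covers. The invariant kept is that \<open>x p \<in> A\<close> for every \<open>x\<close> in the algebra of
  the nest \<open>E\<close> below \<open>p\<close>; a largest such \<open>p\<close> must be the identity.\<close>

lemma nest_representation:
  obtains E where "E \<subseteq> Lat M A" "nest_in M E" "Alg M E \<subseteq> A"
proof -
  define good where "good p \<longleftrightarrow> p \<in> Lat M A \<and>
    (\<exists>E\<subseteq>Lat M A. nest_in M E \<and> (\<forall>e\<in>E. p \<cdot> e = e) \<and> (\<forall>x\<in>Alg M E. x \<cdot> p \<in> A))" for p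
  have "nest_in M {}"
    by (simp add: nest_in_def)
  then have "good 0"
    unfolding good_def using zero_projection subspace_A
    by (auto intro!: LatI exI[of _ "{}"] simp: cop.subspace_0)
  obtain N where N: "\<And>p. range_dim p \<le> N"
    by (rule range_dim_le) blast
  have "\<exists>p. good p \<and> (\<forall>u. good u \<longrightarrow> range_dim u \<le> range_dim p)"
    using \<open>good 0\<close> by (rule ex_has_greatest_nat[of good 0 range_dim "Suc N"]) (simp add: N less_Suc_eq_le)
  then obtain p where p: "good p" "\<And>u. good u \<Longrightarrow> range_dim u \<le> range_dim p"
    by auto
  obtain E where E: "p \<in> Lat M A" "E \<subseteq> Lat M A" "nest_in M E" "\<And>e. e \<in> E \<Longrightarrow> p \<cdot> e = e"
      "\<And>x. x \<in> Alg M E \<Longrightarrow> x \<cdot> p \<in> A"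
    using p(1) unfolding good_def by blast
  have "p = id_blinfun"
  proof (rule ccontr)
    assume "p \<noteq> id_blinfun"
    then obtain q where cov: "covers q p"
      using cover_above E(1) by blast
    then have q: "q \<in> Lat M A" "q \<cdot> p = p" "q \<noteq> p"
      unfolding covers_def by auto
    have qe: "q \<cdot> e = e" if "e \<in> E" for e
      using compose_eq_cong[OF q(2), of e] E(4)[OF that] by simp
    have qq: "q \<cdot> q = q"
      using LatD q by blast
    have nest: "nest_in M (insert q E)"
      using E(2,3) q(1) qe qq op_le_of_compose LatD(1) unfolding nest_in_def
      by (auto simp: subset_iff)
    have "x \<cdot> q \<in> A" if x: "x \<in> Alg M (insert q E)" for x
    proof -
      have xE: "x \<in> Alg M E" and xM: "x \<in> M" and xq: "x \<cdot> q = q \<cdot> x \<cdot> q"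
        using x unfolding Alg_def by auto
      have "q \<cdot> (q - p) = q - p"
        using qq q by (simp add: op_algebra)
      then have "x \<cdot> q \<cdot> (q - p) = x \<cdot> (q - p)"
        by (simp add: compose_assoc)
      moreover have "q \<cdot> x \<cdot> q \<cdot> (q - p) = q \<cdot> x \<cdot> (q - p)"
        using \<open>q \<cdot> (q - p) = q - p\<close> by (simp add: compose_assoc)
      ultimately have "x \<cdot> (q - p) = q \<cdot> x \<cdot> (q - p)"
        using xq by simp
      then have "x \<cdot> (q - p) \<in> A"
        using cover_columns[OF cov xM] by simp
      then have "x \<cdot> p + x \<cdot> (q - p) \<in> A"
        using E(5)[OF xE] A_add by blast
      then show ?thesis
        by (simp flip: compose_add_right)
    qed
    then have "good q"
      unfolding good_def using q(1) E(2) nest qe qq by (intro conjI exI[of _ "insert q E"]) auto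
    moreover have "range_dim p < range_dim q"
      using range_dim_less q E(1) LatD(1) by metis
    ultimately show False
      using p(2) by fastforce
  qed
  then have "Alg M E \<subseteq> A"
    using E(5) by auto
  then show ?thesis
    using that E by blast
qed

end

theorem corollary4p8:
  fixes M A :: "('h::complex_hilbert_space \<Rightarrow>\<^sub>L 'h) set"
  assumes "von_neumann_algebra M" and "finite_dimensional M"
    and "unital_subalgebra A" and "A \<subseteq> M"
    and "logmodular M A"
  shows "nest_subalgebra M A \<and> reflexive_in M A"
proof -
  interpret logmodular_subalgebra M A
    using assms by unfold_locales (auto simp: von_neumann_algebra_def)
  obtain E where E: "E \<subseteq> Lat M A" "nest_in M E" "Alg M E \<subseteq> A"
    by (rule nest_representation)
  have "A \<subseteq> Alg M (Lat M A)"
    using assms(4) unfolding Alg_def Lat_def by auto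
  moreover have "Alg M (Lat M A) \<subseteq> Alg M E"
    using E(1) unfolding Alg_def by auto
  ultimately show ?thesis
    using E(2,3) unfolding nest_subalgebra_def reflexive_in_def by blast
qed

end
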